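(* Assume the standing conditions on $F$ and $\sigma$ and the eventual strict monotonicity of $F$ (with constants $R,C_4^F>0$) written out in the context. Assume moreover that the top Lyapunov exponent satisfies $\lambda_1^\sigma<0$ and that there exist $r\in(0,1]$, $\overline{C}_F>0$ and $p_1\ge1$ such that for all $y,z\in\mathbb{R}^d$ $$\|D_yF-D_zF\|_{L(\mathbb{R}^d,\mathbb{R}^d)}\le\overline{C}_F(1+|y|+|z|)^{p_1}|y-z|^r.$$ Let $C>0$ be a deterministic constant with $$\int_{\tilde{\mathcal{B}}}(\mu_{\omega^-}\times\mu_{\omega^-})\big(\{(x,y):|x-y|>C\}\big)\,\mathbf{P}(d\omega^-)=0,$$ and suppose that $$\pi\big(\overline{B(0,R+C)}\big)<\frac{C_4^F}{C_3^F+C_4^F}.$$ Then weak synchronization holds for the SDE $dY_t=F(Y_t)dt+\sigma dB^H_t$: there exists a random point $b:\tilde{\mathcal{B}}\to\mathbb{R}^d$ such that $\mathrm{supp}(\mu_{\omega^-})=\{b(\omega^-)\}$ for $\mathbf{P}$-almost every $\omega^-\in\tilde{\mathcal{B}}$.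
   Context: **Noise.** Fix $d\ge1$, $H\in(0,1)$. For $h\in(0,1)$ let $\mathcal{B}_h$ be the closure of $C_0^\infty(\mathbb{R}^-,\mathbb{R}^d)$ (smooth compactly supported $\omega:\mathbb{R}^-=(-\infty,0]\to\mathbb{R}^d$ with $\omega(0)=0$) under $\|\omega\|_{\mathcal{B}_h}:=\sup_{s,t\in\mathbb{R}^-}\frac{|\omega(t)-\omega(s)|}{\sqrt{1+|t|+|s|}\,|t-s|^{(1-h)/2}}$ (a separable Banach space), and write $\mathcal{B}:=\mathcal{B}_H$. $\mathbf{P}$ is the Gaussian measure on $\mathcal{B}$ under which the canonical process is a time-reversed Brownian motion. $\mathcal{D}_H:\mathcal{B}_H\to\mathcal{B}_{1-H}$ is the continuous extension of $\mathcal{D}_H\omega(t)=\frac1{\alpha_H}\int_{-\infty}^0(-r)^{H-1/2}(\dot\omega(t+r)-\dot\omega(r))\,dr$, where $\alpha_H$ is the normalizing constant for which the canonical process under $(\mathcal{D}_H)_*\mathbf{P}$ is a time-reversed fractional Brownian motion with Hurst parameter $H$. For $t\ge0$ put $\vartheta_t\omega(s):=\omega(s-t)-\omega(-t)$ ($s\le0$) and $P_t(\omega^-,\omega^+)(s):=\omega^+(-s-t)-\omega^+(-t)$ for $-t\le s\le0$, $:=\omega^-(s+t)-\omega^+(-t)$ for $s\le-t$. Let $\Omega:=\mathcal{B}\times\mathcal{B}$, $\mathbb{P}:=\mathbf{P}\times\mathbf{P}$, $\theta_t(\omega^-,\omega^+):=(P_t(\omega^-,\omega^+),\vartheta_t\omega^+)$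 for $t\ge0$ and $\theta_t(\omega^-,\omega^+):=(\vartheta_{-t}\omega^-,P_{-t}(\omega^+,\omega^-))$ for $t<0$. Then $B^H_t(\omega):=-(\mathcal{D}_HP_t(\omega^-,\omega^+))(-t)$, $t\ge0$, is a fractional Brownian motion under $\mathbb{P}$. **SDE and standing conditions.** Consider $dY_t=F(Y_t)\,dt+\sigma\,dB^H_t$, $Y_0=x\in\mathbb{R}^d$, with: (1) $\sigma$ an invertible $d\times d$ matrix; (2) for some $C_1^F,C_2^F,C_3^F>0$ and all $\xi_1,\xi_2\in\mathbb{R}^d$, $\langle F(\xi_2)-F(\xi_1),\xi_2-\xi_1\rangle\le\min\{C_1^F-C_2^F|\xi_2-\xi_1|^2,\;C_3^F|\xi_2-\xi_1|^2\}$; (3) $F$ is differentiable and for some $C_F>0$, $N\ge1$: $|F(\xi)|\le C_F(1+|\xi|)^N$ and $|D_\xi F|\le C_F(1+|\xi|)^N$ for all $\xi$; (4) if $H>1/2$, the derivative of $F$ is globally bounded. Let $\Phi^t_\omega(x)$ be the solution: $\Phi^t_\omega(x)=x+\int_0^tF(\Phi^s_\omega(x))\,ds+\sigma B^H_t(\omega)$. Set $\varphi^t_{\omega^-}(x):=\Phi^t_{\theta_{-t}(\omega^-,\omega^+)}(x)$, which depends only on $\omega^-$; then $\Phi^t_{(\omega^-,\omega^+)}(x)=\varphi^t_{P_t(\omega^-,\omega^+)}(x)$. **Invariant measure.** $\mu$ is the (known to exist and be) unique probability measure on $\mathbb{R}^d\times\mathcal{B}$ with $\mathcal{B}$-marginal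 $\mathbf{P}$ that is invariant under the Feller transition semigroup $\mathcal{Q}_t((x,\omega^-);\Gamma):=\int_{\mathcal{B}}\chi_\Gamma\big(\varphi^t_{P_t(\omega^-,\omega^+)}(x),P_t(\omega^-,\omega^+)\big)\mathbf{P}(d\omega^+)$. $\pi$ denotes the marginal of $\mu$ on $\mathbb{R}^d$. **Disintegration.** Fix a measurable $\tilde{\mathcal{B}}\subseteq\mathcal{B}$ with $\mathbf{P}(\tilde{\mathcal{B}})=1$ and probability measures $\{\mu_{\omega^-}\}$ on $\mathbb{R}^d$ (known to exist) such that $\omega^-\mapsto\mu_{\omega^-}(A)$ is measurable and $\mu(A\times D)=\int_D\mu_{\omega^-}(A)\,\mathbf{P}(d\omega^-)$ for Borel $A,D$, and such that for all $(\omega^-,\omega^+)\in\tilde{\mathcal{B}}\times\mathcal{B}$, $t\ge0$: $P_t(\omega^-,\omega^+)\in\tilde{\mathcal{B}}$ and $(\Phi^t_{(\omega^-,\omega^+)})_*\mu_{\omega^-}=\mu_{P_t(\omega^-,\omega^+)}$. **Top Lyapunov exponent.** $\lambda_1=\lambda_1^\sigma\in[-\infty,\infty)$ is the deterministic constant (known to exist) with $\lambda_1=\lim_{t\to\infty}\frac1t\log\|D_x\Phi^t_\omega\|$ for $(\mu\times\mathbf{P})$-almost every $(x,\omega^-,\omega^+)\in\mathbb{R}^d\times\mathcal{B}\times\mathcal{B}$. **Eventual strict monotonicity.** There are $R>0$, $C_4^F>0$ with $\langle F(x)-F(y),x-y\rangle\le-C_4^F|x-y|^2$ whenever $|x|,|y|\ge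 R$. *)

theory Defs
  imports "HOL-Probability.Probability"
begin

text \<open>
  Paths on the half-line \<open>(-\<infinity>, 0]\<close> are represented by functions on all of \<open>\<real>\<close> that vanish on
  \<open>(0, \<infinity>)\<close>, so that distinct functions are distinct paths. Since all paths vanish at \<open>0\<close>, this
  is also the continuous extension by the value at \<open>0\<close>.
\<close>

type_synonym 'n path = "real \<Rightarrow> real ^ 'n"

text \<open>Smoothness on the closed half-line is meant with one-sided derivatives at \<open>0\<close>;
  \<open>D k\<close> is the \<open>k\<close>-th derivative. The support may contain points arbitrarily close to \<open>0\<close>.\<close>

definition test_paths :: "'n::finite path set" where
  "test_paths = {w. (\<forall>t\<ge>0. w t = 0) \<and> (\<exists>a. \<forall>t<a. w t = 0) \<and>
     (\<exists>D. D 0 = w \<and>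
        (\<forall>k. \<forall>t\<le>0. (D k has_vector_derivative D (Suc k) t) (at t within {..0})))}"

text \<open>The norm takes values in \<open>[0, \<infinity>]\<close> as it is also applied outside of the space it defines.
  The pairs with \<open>s = t\<close> contribute \<open>0\<close>, because \<open>x / 0 = 0\<close>.\<close>

definition path_norm :: "real \<Rightarrow> 'n::finite path \<Rightarrow> ennreal" where
  "path_norm h w = (SUP s\<in>{..0}. SUP t\<in>{..0}.
     ennreal (norm (w t - w s) / (sqrt (1 + \<bar>t\<bar> + \<bar>s\<bar>) * \<bar>t - s\<bar> powr ((1 - h) / 2))))"

text \<open>The closure is taken inside the functions vanishing at \<open>0\<close>; those of finite norm form a
  Banach space (the norm dominates point evaluations), so this is the completion.\<close>

definition path_space :: "real \<Rightarrow> 'n::finite path set" where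
  "path_space h = {w. (\<forall>t\<ge>0. w t = 0) \<and>
     (\<forall>e>0. \<exists>v\<in>test_paths. path_norm h (\<lambda>t. w t - v t) < ennreal e)}"

definition path_dist :: "real \<Rightarrow> 'n::finite path \<Rightarrow> 'n path \<Rightarrow> real" where
  "path_dist h v w = enn2real (path_norm h (\<lambda>t. v t - w t))"

definition path_topology :: "real \<Rightarrow> 'n::finite path topology" where
  "path_topology h = Metric_space.mtopology (path_space h) (path_dist h)"

definition path_borel :: "real \<Rightarrow> 'n::finite path measure" where
  "path_borel h = sigma (path_space h) {U. openin (path_topology h) U}"

definition brownian_motion ::
  "'a measure \<Rightarrow> (real \<Rightarrow> 'a \<Rightarrow> real ^ 'n::finite) \<Rightarrow> bool" where
  "brownian_motion M W \<longleftrightarrow> prob_space M \<and>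
     (\<forall>t\<ge>0. W t \<in> borel_measurable M) \<and>
     (AE x in M. W 0 x = 0) \<and>
     (AE x in M. continuous_on {0..} (\<lambda>t. W t x)) \<and>
     (\<forall>n (t :: nat \<Rightarrow> real). 0 \<le> t 0 \<and> mono t \<longrightarrow>
        prob_space.indep_vars M (\<lambda>_. borel) (\<lambda>i x. W (t (Suc i)) x - W (t i) x) {..<n}) \<and>
     (\<forall>s t. 0 \<le> s \<and> s < t \<longrightarrow>
        prob_space.indep_vars M (\<lambda>_. borel) (\<lambda>i x. (W t x - W s x) $ i) UNIV \<and>
        (\<forall>i. distributed M lborel (\<lambda>x. (W t x - W s x) $ i)
               (\<lambda>y. ennreal (normal_density 0 (sqrt (t - s)) y))))"

text \<open>The degenerate case of variance \<open>0\<close> has no density and is listed separately.\<close>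

definition centered_gaussian :: "'a measure \<Rightarrow> ('a \<Rightarrow> real) \<Rightarrow> bool" where
  "centered_gaussian M Y \<longleftrightarrow> Y \<in> borel_measurable M \<and>
     ((AE x in M. Y x = 0) \<or>
      (\<exists>s>0. distributed M lborel Y (\<lambda>y. ennreal (normal_density 0 s y))))"

text \<open>A centered Gaussian process, with independent components, each having the covariance of
  fractional Brownian motion.\<close>

definition fractional_brownian_motion ::
  "real \<Rightarrow> 'a measure \<Rightarrow> (real \<Rightarrow> 'a \<Rightarrow> real ^ 'n::finite) \<Rightarrow> bool" where
  "fractional_brownian_motion H M X \<longleftrightarrow> prob_space M \<and>
     (\<forall>t\<ge>0. X t \<in> borel_measurable M) \<and>
     (\<forall>T (a :: real \<Rightarrow> real ^ 'n). finite T \<and> T \<subseteq> {0..} \<longrightarrow>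
        centered_gaussian M (\<lambda>x. \<Sum>t\<in>T. a t \<bullet> X t x)) \<and>
     (\<forall>s\<ge>0. \<forall>t\<ge>0. \<forall>i j. (\<integral>x. X s x $ i * X t x $ j \<partial>M) =
        (if i = j then (s powr (2 * H) + t powr (2 * H) - \<bar>t - s\<bar> powr (2 * H)) / 2 else 0))"

text \<open>Time reversal: the canonical process \<open>w t\<close>, \<open>t \<le> 0\<close>, is read as \<open>w (- t)\<close>, \<open>t \<ge> 0\<close>.\<close>

definition wiener_measure :: "real \<Rightarrow> 'n::finite path measure \<Rightarrow> bool" where
  "wiener_measure H P \<longleftrightarrow> sets P = sets (path_borel H) \<and> brownian_motion P (\<lambda>t w. w (- t))"

definition fractional_integral :: "real \<Rightarrow> real \<Rightarrow> 'n::finite path \<Rightarrow> 'n path" where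
  "fractional_integral H \<alpha> w = (\<lambda>t. if t \<le> 0 then
     (1 / \<alpha>) *\<^sub>R (LBINT r:{..0}. (- r) powr (H - 1/2) *\<^sub>R
        (vector_derivative w (at (t + r) within {..0}) - vector_derivative w (at r within {..0})))
     else 0)"

text \<open>\<open>D\<close> is the continuous extension of this operator from the (dense) test paths, and \<open>\<alpha>\<close> is the
  constant that turns Brownian motion into normalized fractional Brownian motion. Only the
  values of \<open>D\<close> on \<open>path_space H\<close> are constrained, and they are determined uniquely.\<close>

definition fractional_operator ::
  "real \<Rightarrow> 'n::finite path measure \<Rightarrow> real \<Rightarrow> ('n path \<Rightarrow> 'n path) \<Rightarrow> bool" where
  "fractional_operator H P \<alpha> D \<longleftrightarrow> \<alpha> > 0 \<and>
     continuous_map (path_topology H) (path_topology (1 - H)) D \<and>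
     (\<forall>w\<in>test_paths. D w = fractional_integral H \<alpha> w) \<and>
     fractional_brownian_motion H (distr P (path_borel (1 - H)) D) (\<lambda>t w. w (- t))"

definition path_shift :: "real \<Rightarrow> 'n::finite path \<Rightarrow> 'n path" where
  "path_shift t w = (\<lambda>s. if s \<le> 0 then w (s - t) - w (- t) else 0)"

definition path_concat :: "real \<Rightarrow> 'n::finite path \<times> 'n path \<Rightarrow> 'n path" where
  "path_concat t = (\<lambda>(wm, wp) s.
     if s > 0 then 0
     else if - t \<le> s then wp (- s - t) - wp (- t)
     else wm (s + t) - wp (- t))"

definition noise_shift :: "real \<Rightarrow> 'n::finite path \<times> 'n path \<Rightarrow> 'n path \<times> 'n path" where
  "noise_shift t = (\<lambda>(wm, wp).
     if t \<ge> 0 then (path_concat t (wm, wp), path_shift t wp)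
     else (path_shift (- t) wm, path_concat (- t) (wp, wm)))"

definition driving_noise ::
  "('n::finite path \<Rightarrow> 'n path) \<Rightarrow> real \<Rightarrow> 'n path \<times> 'n path \<Rightarrow> real ^ 'n" where
  "driving_noise D t w = - D (path_concat t w) (- t)"

definition drift_conditions ::
  "real \<Rightarrow> (real ^ 'n::finite \<Rightarrow> real ^ 'n) \<Rightarrow> real \<Rightarrow> bool" where
  "drift_conditions H F C3 \<longleftrightarrow>
     C3 > 0 \<and>
     (\<exists>C1>0. \<exists>C2>0. \<forall>x1 x2. (F x2 - F x1) \<bullet> (x2 - x1)
        \<le> min (C1 - C2 * (norm (x2 - x1))\<^sup>2) (C3 * (norm (x2 - x1))\<^sup>2)) \<and>
     (\<forall>x. F differentiable (at x)) \<and>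
     (\<exists>CF>0. \<exists>N::real. N \<ge> 1 \<and> (\<forall>x. norm (F x) \<le> CF * (1 + norm x) powr N \<and>
        onorm (frechet_derivative F (at x)) \<le> CF * (1 + norm x) powr N)) \<and>
     (H > 1/2 \<longrightarrow> (\<exists>K. \<forall>x. onorm (frechet_derivative F (at x)) \<le> K))"

text \<open>\<open>\<Phi> t w x\<close> is the value at time \<open>t \<ge> 0\<close> of the solution started in \<open>x\<close> and driven by \<open>w\<close>;
  solutions are understood pathwise, for every noise path. They are unique by the one-sided
  Lipschitz bound on \<open>F\<close>.\<close>

definition sde_flow ::
  "real \<Rightarrow> ('n::finite path \<Rightarrow> 'n path) \<Rightarrow> (real ^ 'n \<Rightarrow> real ^ 'n) \<Rightarrow> real ^ 'n ^ 'n \<Rightarrow>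
   (real \<Rightarrow> 'n path \<times> 'n path \<Rightarrow> real ^ 'n \<Rightarrow> real ^ 'n) \<Rightarrow> bool" where
  "sde_flow H D F \<sigma> \<Phi> \<longleftrightarrow>
     (\<forall>w \<in> path_space H \<times> path_space H. \<forall>x.
        continuous_on {0..} (\<lambda>t. \<Phi> t w x) \<and>
        (\<forall>t\<ge>0. \<Phi> t w x = x + integral {0..t} (\<lambda>s. F (\<Phi> s w x)) + \<sigma> *v driving_noise D t w))"

text \<open>The value \<open>\<Phi> t (noise_shift (- t) (wm, wp)) x\<close> does not depend on \<open>wp\<close>; we take \<open>wp = 0\<close>.\<close>

definition past_flow ::
  "(real \<Rightarrow> 'n::finite path \<times> 'n path \<Rightarrow> real ^ 'n \<Rightarrow> real ^ 'n) \<Rightarrow>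
   real \<Rightarrow> 'n path \<Rightarrow> real ^ 'n \<Rightarrow> real ^ 'n" where
  "past_flow \<Phi> t wm x = \<Phi> t (noise_shift (- t) (wm, \<lambda>_. 0)) x"

definition transition ::
  "'n::finite path measure \<Rightarrow> (real \<Rightarrow> 'n path \<times> 'n path \<Rightarrow> real ^ 'n \<Rightarrow> real ^ 'n) \<Rightarrow>
   real \<Rightarrow> (real ^ 'n) \<times> 'n path \<Rightarrow> ((real ^ 'n) \<times> 'n path) set \<Rightarrow> ennreal" where
  "transition P \<Phi> t = (\<lambda>(x, wm) G. \<integral>\<^sup>+ wp.
     indicator G (past_flow \<Phi> t (path_concat t (wm, wp)) x, path_concat t (wm, wp)) \<partial>P)"

definition invariant_measure ::
  "real \<Rightarrow> 'n::finite path measure \<Rightarrow>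
   (real \<Rightarrow> 'n path \<times> 'n path \<Rightarrow> real ^ 'n \<Rightarrow> real ^ 'n) \<Rightarrow>
   ((real ^ 'n) \<times> 'n path) measure \<Rightarrow> bool" where
  "invariant_measure H P \<Phi> \<mu> \<longleftrightarrow>
     prob_space \<mu> \<and> sets \<mu> = sets (borel \<Otimes>\<^sub>M path_borel H) \<and>
     distr \<mu> (path_borel H) snd = P \<and>
     (\<forall>t\<ge>0. \<forall>G\<in>sets \<mu>. (\<integral>\<^sup>+ z. transition P \<Phi> t z G \<partial>\<mu>) = emeasure \<mu> G)"

definition unique_invariant_measure ::
  "real \<Rightarrow> 'n::finite path measure \<Rightarrow>
   (real \<Rightarrow> 'n path \<times> 'n path \<Rightarrow> real ^ 'n \<Rightarrow> real ^ 'n) \<Rightarrow>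
   ((real ^ 'n) \<times> 'n path) measure \<Rightarrow> bool" where
  "unique_invariant_measure H P \<Phi> \<mu> \<longleftrightarrow>
     invariant_measure H P \<Phi> \<mu> \<and> (\<forall>\<nu>. invariant_measure H P \<Phi> \<nu> \<longrightarrow> \<nu> = \<mu>)"

text \<open>\<open>Bt\<close> is the full-measure set of past paths, \<open>K wm\<close> the conditional measure given \<open>wm\<close>.\<close>

definition flow_disintegration ::
  "real \<Rightarrow> 'n::finite path measure \<Rightarrow>
   (real \<Rightarrow> 'n path \<times> 'n path \<Rightarrow> real ^ 'n \<Rightarrow> real ^ 'n) \<Rightarrow>
   ((real ^ 'n) \<times> 'n path) measure \<Rightarrow> 'n path set \<Rightarrow>
   ('n path \<Rightarrow> (real ^ 'n) measure) \<Rightarrow> bool" where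
  "flow_disintegration H P \<Phi> \<mu> Bt K \<longleftrightarrow>
     Bt \<in> sets P \<and> emeasure P Bt = 1 \<and>
     (\<forall>wm\<in>path_space H. prob_space (K wm) \<and> sets (K wm) = sets borel) \<and>
     (\<forall>A\<in>sets borel. (\<lambda>wm. emeasure (K wm) A) \<in> borel_measurable P) \<and>
     (\<forall>A\<in>sets borel. \<forall>E\<in>sets P.
        emeasure \<mu> (A \<times> E) = (\<integral>\<^sup>+ wm\<in>E. emeasure (K wm) A \<partial>P)) \<and>
     (\<forall>wm\<in>Bt. \<forall>wp\<in>path_space H. \<forall>t\<ge>0.
        path_concat t (wm, wp) \<in> Bt \<and>
        distr (K wm) borel (\<Phi> t (wm, wp)) = K (path_concat t (wm, wp)))"

text \<open>The derivative of the flow is invertible, so the logarithm is never taken at \<open>0\<close>.\<close>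

definition top_lyapunov_exponent ::
  "'n::finite path measure \<Rightarrow>
   (real \<Rightarrow> 'n path \<times> 'n path \<Rightarrow> real ^ 'n \<Rightarrow> real ^ 'n) \<Rightarrow>
   ((real ^ 'n) \<times> 'n path) measure \<Rightarrow> ereal \<Rightarrow> bool" where
  "top_lyapunov_exponent P \<Phi> \<mu> l \<longleftrightarrow> l < \<infinity> \<and>
     (AE ((x, wm), wp) in \<mu> \<Otimes>\<^sub>M P.
        ((\<lambda>t. ereal (ln (onorm (frechet_derivative (\<Phi> t (wm, wp)) (at x))) / t)) \<longlongrightarrow> l) at_top)"

definition measure_support :: "'a::topological_space measure \<Rightarrow> 'a set" where
  "measure_support M = {x. \<forall>U. open U \<and> x \<in> U \<longrightarrow> emeasure M U > 0}"

end

theory Submission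
  imports Defs
begin

text \<open>
  Draw two points \<open>x\<close>, \<open>y\<close> independently from the conditional measure \<open>K wm\<close>, the second one
  conditioned to differ from the first. The flow is injective and maps \<open>K wm\<close> to the
  conditional measure of the new past, so the law of the triple \<open>(wm, x, y)\<close> is stationary. The
  derivative of \<open>ln (1 + \<bar>x - y\<bar>\<^sup>2 / \<epsilon>)\<close> along the flow is at most \<open>2 C3\<close> everywhere, and, because
  \<open>\<bar>x - y\<bar> \<le> C\<close>, at most about \<open>- 2 C4\<close> where \<open>\<bar>x\<bar> > R + C\<close>. By stationarity its mean vanishes. If
  \<open>K wm\<close> is almost surely not a point mass, then \<open>x\<close> alone has the law \<open>\<pi>\<close>, and letting \<open>\<epsilon> \<rightarrow> 0\<close> gives
  \<open>0 \<le> C3 \<pi>(cball 0 (R + C)) - C4 (1 - \<pi>(cball 0 (R + C)))\<close>, contrary to the assumption.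
  Hence \<open>K wm\<close> is a point mass with positive probability. This event does not depend on the recent
  past, so it has probability one by a zero-one law.
\<close>

section \<open>The path space\<close>

text \<open>Conditioning on distinct points is what produces the exact law \<open>\<pi>\<close>.
  Pairs on the diagonal dissipate nothing, so atoms of \<open>K wm\<close> would spoil the constants
  if the two points were merely independent. Once the diagonal is removed, the first point still has
  law \<open>K wm\<close>, because the weight \<open>1 / (1 - K wm {x})\<close> normalises the fibre
  over each \<open>x\<close>; injectivity of the flow is what carries this weight along. One point
  suffices because \<open>\<bar>x\<bar> > R + C\<close> and \<open>\<bar>x - y\<bar> \<le> C\<close>
  force \<open>\<bar>y\<bar> > R\<close>; this explains the radius \<open>R + C\<close>. Both
  limits, of the time step and of \<open>\<epsilon>\<close>, are taken by Fatou's lemma, and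
  subtracting the derivative from its upper bound \<open>2 C3\<close> supplies the nonnegative
  integrands. On the noise side the obstacle is measurability in a function space with a Hoelder
  norm. Separability reduces it to evaluations at single times. Stationarity of the noise under
  concatenation is extracted from the invariance of \<open>\<mu>\<close>, not computed from Brownian
  increments.\<close>

lemma path_norm_leI:
  assumes "\<And>s t. s \<le> 0 \<Longrightarrow> t \<le> 0 \<Longrightarrow> s \<noteq> t \<Longrightarrow>
    norm (w t - w s) \<le> B * (sqrt (1 + \<bar>t\<bar> + \<bar>s\<bar>) * \<bar>t - s\<bar> powr ((1 - h) / 2))" and "B \<ge> 0"
  shows "path_norm h w \<le> ennreal B"
  unfolding path_norm_def
proof (intro SUP_least ennreal_leI)
  fix s t :: real assume st: "s \<in> {..0}" "t \<in> {..0}"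
  show "norm (w t - w s) / (sqrt (1 + \<bar>t\<bar> + \<bar>s\<bar>) * \<bar>t - s\<bar> powr ((1 - h) / 2)) \<le> B"
  proof (cases "s = t")
    case False
    then have "sqrt (1 + \<bar>t\<bar> + \<bar>s\<bar>) * \<bar>t - s\<bar> powr ((1 - h) / 2) > 0"
      by (intro mult_pos_pos) auto
    then show ?thesis
      using assms(1)[of s t] False st by (simp add: divide_le_eq)
  qed (use assms(2) in simp)
qed

lemma path_norm_ge:
  assumes "s \<le> 0" "t \<le> 0"
  shows "ennreal (norm (w t - w s) / (sqrt (1 + \<bar>t\<bar> + \<bar>s\<bar>) * \<bar>t - s\<bar> powr ((1 - h) / 2))) \<le> path_norm h w"
  unfolding path_norm_def
  by (rule SUP_upper2[of s], use assms in simp, rule SUP_upper) (use assms in simp)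

lemma path_increment_le:
  assumes "path_norm h w < \<infinity>" "s \<le> 0" "t \<le> 0"
  shows "norm (w t - w s)
    \<le> enn2real (path_norm h w) * (sqrt (1 + \<bar>t\<bar> + \<bar>s\<bar>) * \<bar>t - s\<bar> powr ((1 - h) / 2))"
proof (cases "s = t")
  case False
  then have "sqrt (1 + \<bar>t\<bar> + \<bar>s\<bar>) * \<bar>t - s\<bar> powr ((1 - h) / 2) > 0"
    by (intro mult_pos_pos) auto
  moreover have "norm (w t - w s) / (sqrt (1 + \<bar>t\<bar> + \<bar>s\<bar>) * \<bar>t - s\<bar> powr ((1 - h) / 2))
      \<le> enn2real (path_norm h w)"
    using enn2real_mono[OF path_norm_ge[OF assms(2,3)]] assms(1) by simp
  ultimately show ?thesis
    by (simp add: divide_le_eq)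
qed simp

lemma path_norm_triangle: "path_norm h (\<lambda>t. v t + w t) \<le> path_norm h v + path_norm h w"
proof -
  have "ennreal (norm ((v t + w t) - (v s + w s)) / (sqrt (1 + \<bar>t\<bar> + \<bar>s\<bar>) * \<bar>t - s\<bar> powr ((1 - h) / 2)))
      \<le> path_norm h v + path_norm h w" if "s \<le> 0" "t \<le> 0" for s t
  proof -
    let ?q = "sqrt (1 + \<bar>t\<bar> + \<bar>s\<bar>) * \<bar>t - s\<bar> powr ((1 - h) / 2)"
    have "norm ((v t + w t) - (v s + w s)) / ?q \<le> norm (v t - v s) / ?q + norm (w t - w s) / ?q"
      unfolding add_divide_distrib[symmetric]
      by (intro divide_right_mono order_trans[OF _ norm_triangle_ineq]) (auto simp: algebra_simps)
    then have "ennreal (norm ((v t + w t) - (v s + w s)) / ?q)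
        \<le> ennreal (norm (v t - v s) / ?q) + ennreal (norm (w t - w s) / ?q)"
      by (simp flip: ennreal_plus add: ennreal_leI)
    then show ?thesis
      using add_mono[OF path_norm_ge[OF that, of v h] path_norm_ge[OF that, of w h]] by (rule order_trans)
  qed
  then show ?thesis
    by (subst path_norm_def) (auto intro!: SUP_least)
qed

lemma path_norm_commute: "path_norm h (\<lambda>t. v t - w t) = path_norm h (\<lambda>t. w t - v t)"
proof -
  have "norm (v t - w t - (v s - w s)) = norm (w t - v t - (w s - v s))" for s t
    using norm_minus_cancel[of "v t - w t - (v s - w s)"] by (simp add: algebra_simps)
  then show ?thesis
    by (simp add: path_norm_def)
qed

lemma path_norm_diff_triangle:
  "path_norm h (\<lambda>t. u t - w t) \<le> path_norm h (\<lambda>t. u t - v t) + path_norm h (\<lambda>t. v t - w t)"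
  using path_norm_triangle[of h "\<lambda>t. u t - v t" "\<lambda>t. v t - w t"] by simp

text \<open>\<open>\<eta>\<close> is the scale at which the two bounds are exchanged.\<close>

lemma path_norm_le_interpolation:
  assumes h: "0 < h" "h < 1" and B: "\<And>s t. s \<le> 0 \<Longrightarrow> t \<le> 0 \<Longrightarrow> norm (w t - w s) \<le> B * \<bar>t - s\<bar>"
    and A: "\<And>s t. s \<le> 0 \<Longrightarrow> t \<le> 0 \<Longrightarrow> norm (w t - w s) \<le> A" and \<eta>: "\<eta> > 0" and "A \<ge> 0" "B \<ge> 0"
  shows "path_norm h w \<le> ennreal (B * \<eta> powr ((1 + h) / 2) + A * \<eta> powr (- ((1 - h) / 2)))"
proof (rule path_norm_leI)
  fix s t :: real assume st: "s \<le> 0" "t \<le> 0" "s \<noteq> t"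
  let ?K = "B * \<eta> powr ((1 + h) / 2) + A * \<eta> powr (- ((1 - h) / 2))" and ?b = "(1 - h) / 2"
  have "norm (w t - w s) \<le> ?K * \<bar>t - s\<bar> powr ?b"
  proof (cases "\<bar>t - s\<bar> \<le> \<eta>")
    case True
    have "\<bar>t - s\<bar> = \<bar>t - s\<bar> powr ((1 + h) / 2) * \<bar>t - s\<bar> powr ?b"
      using st by (simp flip: powr_add add: field_simps)
    also have "\<dots> \<le> \<eta> powr ((1 + h) / 2) * \<bar>t - s\<bar> powr ?b"
      using True h by (intro mult_right_mono powr_mono2) auto
    finally have "B * \<bar>t - s\<bar> \<le> B * \<eta> powr ((1 + h) / 2) * \<bar>t - s\<bar> powr ?b"
      using \<open>B \<ge> 0\<close> by (metis mult.assoc mult_left_mono)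
    then show ?thesis
      using B[OF st(1,2)] \<open>A \<ge> 0\<close> by (smt (verit) distrib_right mult_nonneg_nonneg powr_ge_zero)
  next
    case False
    have "1 = \<eta> powr (- ?b) * \<eta> powr ?b"
      using \<eta> by (simp flip: powr_add)
    also have "\<dots> \<le> \<eta> powr (- ?b) * \<bar>t - s\<bar> powr ?b"
      using False h \<eta> by (intro mult_left_mono powr_mono2) auto
    finally have "A \<le> A * \<eta> powr (- ?b) * \<bar>t - s\<bar> powr ?b"
      using \<open>A \<ge> 0\<close> by (metis mult.assoc mult.right_neutral mult_left_mono)
    then show ?thesis
      using A[OF st(1,2)] \<open>B \<ge> 0\<close> by (smt (verit) distrib_right mult_nonneg_nonneg powr_ge_zero)
  qed
  also have "\<dots> \<le> ?K * (sqrt (1 + \<bar>t\<bar> + \<bar>s\<bar>) * \<bar>t - s\<bar> powr ?b)"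
    using \<open>A \<ge> 0\<close> \<open>B \<ge> 0\<close> mult_right_mono[of 1 "sqrt (1 + \<bar>t\<bar> + \<bar>s\<bar>)" "\<bar>t - s\<bar> powr ?b"]
    by (intro mult_left_mono) auto
  finally show "norm (w t - w s) \<le> ?K * (sqrt (1 + \<bar>t\<bar> + \<bar>s\<bar>) * \<bar>t - s\<bar> powr ?b)" .
qed (use assms in auto)

text \<open>One integer bounds both the support and the Lipschitz constant, so that countably many
  classes exhaust the test paths. This is all the regularity that the separability argument takes
  from smoothness.\<close>

definition Lipschitz_paths :: "nat \<Rightarrow> 'n::finite path set" where
  "Lipschitz_paths n = {w. w 0 = 0 \<and> (\<forall>t<(- real n). w t = 0) \<and>
     (\<forall>s\<le>0. \<forall>t\<le>0. norm (w t - w s) \<le> real n * \<bar>t - s\<bar>)}"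

text \<open>The first derivative is continuous, hence bounded on a compact interval outside of which
  the path vanishes, and the mean value inequality applies there.\<close>

lemma test_paths_Lipschitz:
  fixes w :: "'n::finite path"
  assumes "w \<in> test_paths"
  obtains n where "w \<in> Lipschitz_paths n"
proof -
  from assms obtain a D where w0: "w 0 = 0" and a: "\<And>t. t < a \<Longrightarrow> w t = 0"
    and D: "D 0 = w" "\<And>k t. t \<le> 0 \<Longrightarrow> (D k has_vector_derivative D (Suc k) t) (at t within {..0})"
    unfolding test_paths_def by auto
  \<comment> \<open>Subtracting 1 makes the path vanish at \<open>c\<close> itself and not only to
    its left; the bound \<open>- 1\<close> keeps \<open>c\<close> in the half-line.\<close>
  define c where "c = min (a - 1) (- 1)"
  have c: "c \<le> 0" "\<And>t. t \<le> c \<Longrightarrow> w t = 0"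
    using a by (auto simp: c_def)
  have "continuous_on {..0} (D 1)"
    using D(2)[of _ 1] by (auto simp: continuous_on_eq_continuous_within intro: has_vector_derivative_continuous)
  then have "bounded (D 1 ` {c..0})"
    by (intro compact_imp_bounded compact_continuous_image) (auto intro: continuous_on_subset)
  then obtain B where B: "\<And>t. c \<le> t \<Longrightarrow> t \<le> 0 \<Longrightarrow> norm (D 1 t) \<le> B"
    unfolding bounded_iff by (metis (no_types, lifting) atLeastAtMost_iff imageI)
  have L: "norm (w t - w s) \<le> B * norm (t - s)" if "s \<in> {c..0}" "t \<in> {c..0}" for s t
  proof (rule differentiable_bound[of "{c..0}" w "\<lambda>x h. h *\<^sub>R D 1 x"])
    show "(w has_derivative (\<lambda>h. h *\<^sub>R D 1 x)) (at x within {c..0})" if "x \<in> {c..0}" for x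
      using D(2)[of x 0] that unfolding D(1) has_vector_derivative_def
      by (auto intro: has_derivative_subset)
    show "onorm (\<lambda>h. h *\<^sub>R D 1 x) \<le> B" if "x \<in> {c..0}" for x
    proof (rule onorm_bound)
      show "B \<ge> 0"
        using B[of x] that norm_ge_zero[of "D 1 x"] by (simp del: norm_ge_zero)
      show "norm (k *\<^sub>R D 1 x) \<le> B * norm k" for k
        using mult_right_mono[OF B, of x "norm k"] that by (simp add: mult.commute)
    qed
  qed (use that in auto)
  define n where "n = nat \<lceil>max (max \<bar>B\<bar> (- c)) 0\<rceil>"
  have n: "\<bar>B\<bar> \<le> real n" "- c \<le> real n"
    unfolding n_def by linarith+
  \<comment> \<open>Moving an argument below \<open>c\<close> up to \<open>c\<close> changes no
    value, and \<open>max t c\<close> is 1-Lipschitz in \<open>t\<close>, so the bound on the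
    compact interval extends to the half-line.\<close>
  have clamp: "w t = w (max t c)" for t
    using c by (cases "t \<le> c") (auto simp: max_def)
  have "norm (w t - w s) \<le> real n * \<bar>t - s\<bar>" if "s \<le> 0" "t \<le> 0" for s t
  proof -
    have "norm (w t - w s) \<le> B * norm (max t c - max s c)"
      using L[of "max s c" "max t c"] that c(1) clamp[of s] clamp[of t] by simp
    also have "\<dots> \<le> real n * \<bar>t - s\<bar>"
      using n by (intro mult_mono) auto
    finally show ?thesis .
  qed
  moreover have "w t = 0" if "t < - real n" for t
    using c n that by auto
  ultimately have "w \<in> Lipschitz_paths n"
    using w0 by (simp add: Lipschitz_paths_def)
  then show thesis
    using that by blast
qed

text \<open>Interpolation at scale 1: a path with Lipschitz constant \<open>n\<close> that is 0 at
  the origin and below \<open>- n\<close> is bounded by \<open>n * n\<close>, which bounds its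
  increments too.\<close>

lemma path_norm_test_paths:
  assumes "0 < h" "h < 1" "w \<in> test_paths"
  shows "path_norm h w < \<infinity>"
proof -
  obtain n where n: "w \<in> Lipschitz_paths n"
    using test_paths_Lipschitz[OF assms(3)] by blast
  have b: "norm (w t) \<le> real n * real n" if "t \<le> 0" for t
  proof (cases "t < - real n")
    case False
    have "norm (w t) \<le> real n * \<bar>t\<bar>"
      using n that unfolding Lipschitz_paths_def by (metis (mono_tags, lifting) diff_zero mem_Collect_eq order_refl)
    also have "\<dots> \<le> real n * real n"
      using False that by (intro mult_left_mono) auto
    finally show ?thesis .
  qed (use n in \<open>simp add: Lipschitz_paths_def\<close>)
  have "path_norm h w \<le> ennreal (real n * 1 powr ((1 + h) / 2) + 2 * (real n * real n) * 1 powr (- ((1 - h) / 2)))"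
  proof (rule path_norm_le_interpolation[OF assms(1,2)])
    show "norm (w t - w s) \<le> real n * \<bar>t - s\<bar>" if "s \<le> 0" "t \<le> 0" for s t
      using n that by (auto simp: Lipschitz_paths_def)
    show "norm (w t - w s) \<le> 2 * (real n * real n)" if "s \<le> 0" "t \<le> 0" for s t
      using b[of s] b[of t] that norm_triangle_ineq4[of "w t" "w s"] by linarith
  qed auto
  also have "\<dots> < \<infinity>" by simp
  finally show ?thesis .
qed

lemma test_paths_subset: "test_paths \<subseteq> (path_space h :: 'n::finite path set)"
proof
  fix w :: "'n path" assume w: "w \<in> test_paths"
  have "path_norm h (\<lambda>t. w t - w t) = 0"
    by (simp add: path_norm_def bot_ennreal)
  then have "\<exists>v\<in>test_paths. path_norm h (\<lambda>t. w t - v t) < ennreal e" if "e > 0" for e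
    using w that by (intro bexI[of _ w]) auto
  then show "w \<in> path_space h"
    using w by (simp add: path_space_def test_paths_def)
qed

section \<open>Metric, separability and Borel sets of the path space\<close>

context
  fixes h :: real
  assumes h: "0 < h" "h < 1"
begin

lemma path_norm_finite:
  assumes "w \<in> path_space h"
  shows "path_norm h w < \<infinity>"
proof -
  obtain v where v: "v \<in> test_paths" "path_norm h (\<lambda>t. w t - v t) < ennreal 1"
    using assms unfolding path_space_def by (auto dest: spec[of _ 1])
  have "path_norm h w \<le> path_norm h (\<lambda>t. w t - v t) + path_norm h v"
    using path_norm_triangle[of h "\<lambda>t. w t - v t" v] by simp
  also have "\<dots> < \<infinity>"
    using v path_norm_test_paths[OF h v(1)] by (auto simp: less_top[symmetric])
  finally show ?thesis .
qed

lemma path_norm_diff_finite: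
  assumes "v \<in> path_space h" "w \<in> path_space h"
  shows "path_norm h (\<lambda>t. v t - w t) < \<infinity>"
proof -
  have "path_norm h (\<lambda>t. 0 - w t) = path_norm h (\<lambda>t. w t - 0)"
    by (rule path_norm_commute)
  then show ?thesis
    using path_norm_diff_triangle[of h v w "\<lambda>_. 0"] path_norm_finite[OF assms(1)] path_norm_finite[OF assms(2)]
    by (simp add: order_le_less_trans)
qed

lemma path_dist_less_iff:
  assumes "v \<in> path_space h" "w \<in> path_space h"
  shows "path_dist h v w < r \<longleftrightarrow> path_norm h (\<lambda>t. w t - v t) < ennreal r"
  using path_norm_diff_finite[OF assms] path_norm_diff_finite[OF assms(2,1)]
  unfolding path_dist_def path_norm_commute[of h v w]
  by (cases "path_norm h (\<lambda>t. w t - v t)") (auto simp: ennreal_less_iff)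

lemma Metric_space_path_space: "Metric_space (path_space h) (path_dist h :: 'n::finite path \<Rightarrow> _)"
proof
  fix u v w :: "'n path"
  show "0 \<le> path_dist h v w" by (simp add: path_dist_def)
  show "path_dist h v w = path_dist h w v" by (simp add: path_dist_def path_norm_commute[of h v w])
  assume v: "v \<in> path_space h" and w: "w \<in> path_space h"
  show "path_dist h v w = 0 \<longleftrightarrow> v = w"
  proof
    assume eq: "path_dist h v w = 0"
    have "v t = w t" for t
    proof (cases "t \<le> 0")
      case True
      then have "norm ((v t - w t) - (v 0 - w 0)) \<le> 0"
        using path_increment_le[OF path_norm_diff_finite[OF v w], of 0 t] eq by (simp add: path_dist_def)
      then show ?thesis
        using v w by (simp add: path_space_def)
    qed (use v w in \<open>auto simp: path_space_def\<close>)
    then show "v = w" by auto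
  next
    assume "v = w" then show "path_dist h v w = 0"
      by (simp add: path_dist_def path_norm_def bot_ennreal)
  qed
  assume u: "u \<in> path_space h"
  have "path_norm h (\<lambda>t. u t - w t) \<le> path_norm h (\<lambda>t. u t - v t) + path_norm h (\<lambda>t. v t - w t)"
    by (rule path_norm_diff_triangle)
  then show "path_dist h u w \<le> path_dist h u v + path_dist h v w"
    using path_norm_diff_finite[OF u v] path_norm_diff_finite[OF v w] unfolding path_dist_def
    by (subst enn2real_plus[symmetric]) (auto intro!: enn2real_mono simp: less_top[symmetric])
qed

lemma path_continuous:
  assumes "w \<in> path_space h" "x \<longlonglongrightarrow> s" "\<And>k. x k \<le> 0" "s \<le> 0"
  shows "(\<lambda>k. w (x k)) \<longlonglongrightarrow> w s"
proof (rule Lim_transform[OF tendsto_const], rule Lim_null_comparison)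
  show "\<forall>\<^sub>F k in sequentially. norm (w (x k) - w s) \<le>
    enn2real (path_norm h w) * (sqrt (1 + \<bar>x k\<bar> + \<bar>s\<bar>) * \<bar>x k - s\<bar> powr ((1 - h) / 2))"
    using assms by (intro always_eventually allI path_increment_le path_norm_finite) auto
  have "(\<lambda>k. enn2real (path_norm h w) * (sqrt (1 + \<bar>x k\<bar> + \<bar>s\<bar>) * \<bar>x k - s\<bar> powr ((1 - h) / 2)))
     \<longlonglongrightarrow> enn2real (path_norm h w) * (sqrt (1 + \<bar>s\<bar> + \<bar>s\<bar>) * \<bar>s - s\<bar> powr ((1 - h) / 2))"
    using assms h by (intro tendsto_intros tendsto_powr') auto
  then show "(\<lambda>k. enn2real (path_norm h w) * (sqrt (1 + \<bar>x k\<bar> + \<bar>s\<bar>) * \<bar>x k - s\<bar> powr ((1 - h) / 2))) \<longlonglongrightarrow> 0"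
    by simp
qed


text \<open>Paths are continuous on the half-line, so rational times determine the supremum. Writing
  times as \<open>- \<bar>t\<bar>\<close> lets the index run through all of \<open>\<rat>\<close>.
  The countable form makes the norm of a random path measurable.\<close>

lemma path_norm_countable_SUP:
  assumes w: "w \<in> path_space h" and v: "v \<in> path_space h"
  shows "path_norm h (\<lambda>t. w t - v t) =
    (SUP s\<in>\<rat>. SUP t\<in>\<rat>. ennreal (norm ((w (- \<bar>t\<bar>) - v (- \<bar>t\<bar>)) - (w (- \<bar>s\<bar>) - v (- \<bar>s\<bar>))) /
      (sqrt (1 + \<bar>t\<bar> + \<bar>s\<bar>) * \<bar>\<bar>t\<bar> - \<bar>s\<bar>\<bar> powr ((1 - h) / 2))))" (is "?l = ?r")
proof (rule antisym)
  let ?u = "\<lambda>t. w t - v t"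
  have "ennreal (norm (?u t - ?u s) / (sqrt (1 + \<bar>t\<bar> + \<bar>s\<bar>) * \<bar>t - s\<bar> powr ((1 - h) / 2))) \<le> ?r"
    if st: "s \<le> 0" "t \<le> 0" for s t
  proof (cases "s = t")
    case False
    \<comment> \<open>The rationals lie strictly above \<open>- s\<close>, so their negatives
      approach \<open>s\<close> from the left and stay in the half-line, even for
      \<open>s = 0\<close>.\<close>
    have "\<exists>q. (\<forall>k. q k \<in> \<rat> \<and> q k \<ge> 0) \<and> (\<lambda>k. - q k) \<longlonglongrightarrow> s" if "s \<le> 0" for s :: real
    proof -
      have "\<exists>q\<in>\<rat>. - s < q \<and> q < - s + 1 / real (Suc k)" for k
        using Rats_dense_in_real[of "- s" "- s + 1 / real (Suc k)"] by auto
      then obtain q where q: "\<And>k. q k \<in> \<rat>" "\<And>k. - s < q k" "\<And>k. q k < - s + 1 / real (Suc k)"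
        by metis
      have "(\<lambda>k. - s + 1 / real (Suc k)) \<longlonglongrightarrow> - s + 0"
        by (intro tendsto_intros LIMSEQ_Suc lim_1_over_n)
      then have "q \<longlonglongrightarrow> - s"
        by (intro tendsto_sandwich[OF _ _ tendsto_const, of "- s" q]) (use q in \<open>auto intro!: always_eventually less_imp_le\<close>)
      then show ?thesis
        using q that tendsto_minus[of q "- s"] by (intro exI[of _ q]) (auto, smt (verit))
    qed
    then obtain p q where p: "\<And>k. p k \<in> \<rat>" "\<And>k. p k \<ge> 0" "(\<lambda>k. - p k) \<longlonglongrightarrow> s"
      and q: "\<And>k. q k \<in> \<rat>" "\<And>k. q k \<ge> 0" "(\<lambda>k. - q k) \<longlonglongrightarrow> t"
      using st by metis
    let ?f = "\<lambda>k. norm (?u (- q k) - ?u (- p k)) /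
      (sqrt (1 + \<bar>- q k\<bar> + \<bar>- p k\<bar>) * \<bar>- q k - - p k\<bar> powr ((1 - h) / 2))"
    have "?f \<longlonglongrightarrow> norm (?u t - ?u s) / (sqrt (1 + \<bar>t\<bar> + \<bar>s\<bar>) * \<bar>t - s\<bar> powr ((1 - h) / 2))"
      using p q st False
      by (intro tendsto_intros path_continuous[OF w] path_continuous[OF v]) auto
    then have lim: "(\<lambda>k. ennreal (?f k)) \<longlonglongrightarrow> ennreal (norm (?u t - ?u s) / (sqrt (1 + \<bar>t\<bar> + \<bar>s\<bar>) * \<bar>t - s\<bar> powr ((1 - h) / 2)))"
      by (rule tendsto_ennrealI)
    have "ennreal (?f k) \<le> ?r" for k
      using p(1,2)[of k] q(1,2)[of k]
      by (intro SUP_upper2[of "p k"] SUP_upper2[of "q k"]) (auto simp: abs_minus_commute)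
    then show ?thesis
      by (intro LIMSEQ_le_const2[OF lim]) auto
  qed simp
  then show "?l \<le> ?r"
    unfolding path_norm_def by (intro SUP_least) auto
  show "?r \<le> ?l"
  proof (intro SUP_least)
    fix s t :: real
    show "ennreal (norm (?u (- \<bar>t\<bar>) - ?u (- \<bar>s\<bar>)) / (sqrt (1 + \<bar>t\<bar> + \<bar>s\<bar>) * \<bar>\<bar>t\<bar> - \<bar>s\<bar>\<bar> powr ((1 - h) / 2))) \<le> ?l"
      using path_norm_ge[of "- \<bar>s\<bar>" "- \<bar>t\<bar>" ?u h] by (simp add: abs_minus_commute)
  qed
qed

text \<open>\<open>\<delta>\<close> controls the grid of width \<open>1 / m\<close>; the remaining
  \<open>2 * n / m\<close> is one increment of each path between \<open>t\<close> and the next grid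
  point on its right. Left of \<open>- n\<close> both paths vanish, so finitely many grid points
  suffice.\<close>

lemma Lipschitz_paths_near:
  assumes v: "v \<in> Lipschitz_paths n" and w: "w \<in> Lipschitz_paths n" and "m > 0"
    and near: "\<And>k. k \<le> n * m \<Longrightarrow> norm (w (- real k / real m) - v (- real k / real m)) \<le> \<delta>"
    and t: "t \<le> 0" and "\<delta> \<ge> 0"
  shows "norm (w t - v t) \<le> \<delta> + 2 * real n / real m"
proof (cases "t < - real n")
  case True
  then show ?thesis
    using v w \<open>\<delta> \<ge> 0\<close> by (simp add: Lipschitz_paths_def)
next
  case False
  define k where "k = nat \<lfloor>- t * real m\<rfloor>"
  define s where "s = - real k / real m"
  have k: "real k \<le> - t * real m" "- t * real m < real k + 1"
    using t \<open>m > 0\<close> unfolding k_def by (auto simp: mult_nonpos_nonneg)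
  have "- t * real m \<le> real (n * m)"
    using mult_right_mono[of "- t" "real n" "real m"] False by simp
  then have "k \<le> n * m"
    using k(1) by linarith
  have "\<bar>t - s\<bar> \<le> 1 / real m"
  proof -
    have "t - s = (t * real m + real k) / real m"
      using \<open>m > 0\<close> by (simp add: s_def add_divide_distrib)
    then show ?thesis
      using k by (simp add: abs_divide divide_right_mono)
  qed
  then have *: "real n * \<bar>t - s\<bar> \<le> real n / real m"
    using mult_left_mono[of "\<bar>t - s\<bar>" "1 / real m" "real n"] by simp
  have "s \<le> 0" by (simp add: s_def)
  have "norm (w t - v t) \<le> norm (w t - w s) + norm (w s - v s) + norm (v t - v s)"
    using norm_triangle_ineq[of "w t - w s + (w s - v s)" "v s - v t"]
      norm_triangle_ineq[of "w t - w s" "w s - v s"] by (simp add: norm_minus_commute)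
  moreover have "norm (w t - w s) \<le> real n * \<bar>t - s\<bar>" "norm (v t - v s) \<le> real n * \<bar>t - s\<bar>"
    using v w t \<open>s \<le> 0\<close> by (auto simp: Lipschitz_paths_def)
  moreover have "norm (w s - v s) \<le> \<delta>"
    unfolding s_def by (rule near) fact
  ultimately show ?thesis
    using * by simp
qed

text \<open>Test paths are dense by construction, so only they have to be approximated. Within one
  Lipschitz class, uniform closeness implies closeness in norm by interpolation.\<close>

lemma path_space_separable:
  obtains S :: "'n::finite path set" where "countable S" "S \<subseteq> path_space h"
    "\<And>w e. w \<in> path_space h \<Longrightarrow> e > 0 \<Longrightarrow> \<exists>v\<in>S. path_norm h (\<lambda>t. w t - v t) < ennreal e"
proof -
  obtain Q :: "(real ^ 'n) set" where Q: "countable Q" "\<And>U. open U \<Longrightarrow> U \<noteq> {} \<Longrightarrow> \<exists>d\<in>Q. d \<in> U"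
    using countable_dense_setE by blast
  have "\<exists>c. \<forall>x. dist x (from_nat_into Q (c x)) < e" if "e > 0" for e
  proof -
    have "\<exists>i. dist x (from_nat_into Q i) < e" for x
    proof -
      obtain d where "d \<in> Q" "d \<in> ball x e"
        using Q(2)[of "ball x e"] \<open>e > 0\<close> by auto
      then show ?thesis
        using from_nat_into_surj[OF Q(1)] by (metis mem_ball)
    qed
    then show ?thesis by metis
  qed
  then have "\<forall>m. \<exists>c. \<forall>x. dist x (from_nat_into Q (c x)) < 1 / real (Suc m)"
    by simp
  then obtain c where c: "\<And>m x. dist x (from_nat_into Q (c m x)) < 1 / real (Suc m)"
    by metis
  text \<open>The code of a path rounds its values on a grid to the countable dense set \<open>Q\<close>. Paths with the
    same code are close, so one representative per code suffices.\<close>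
  define code :: "nat \<Rightarrow> nat \<Rightarrow> 'n path \<Rightarrow> nat list" where
    "code n m w = map (\<lambda>k. c m (w (- real k / real (Suc m)))) [0..<Suc (n * Suc m)]" for n m w
  define A where "A = (\<lambda>(n, m, l). {w \<in> test_paths \<inter> Lipschitz_paths n. code n m w = l})"
  define S where "S = (\<lambda>i. SOME w. w \<in> A i) ` {i. A i \<noteq> {}}"
  have some: "(SOME w. w \<in> A i) \<in> A i" if "A i \<noteq> {}" for i
    using that by (simp add: some_in_eq)
  have S_test: "S \<subseteq> test_paths"
    using some unfolding S_def by (fastforce simp: A_def)
  have approx: "\<exists>v\<in>S. path_norm h (\<lambda>t. w t - v t) < ennreal e" if w: "w \<in> test_paths" and "e > 0" for w e
  proof -
    obtain n where n: "w \<in> Lipschitz_paths n"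
      using test_paths_Lipschitz[OF w] by blast
    \<comment> \<open>The scale \<open>\<eta>\<close> is fixed first, to make the Lipschitz part of
      the interpolation bound smaller than \<open>e / 2\<close>. Only then is the grid refined,
      because the coefficient \<open>\<kappa>\<close> of the uniform part depends on
      \<open>\<eta>\<close>.\<close>
    have "((\<lambda>\<eta>. 2 * real n * \<eta> powr ((1 + h) / 2)) \<longlongrightarrow> 2 * real n * 0 powr ((1 + h) / 2)) (at_right 0)"
      using h by (intro tendsto_intros tendsto_powr') (auto simp: eventually_at_right_field intro: exI[of _ 1])
    then have "\<forall>\<^sub>F \<eta> in at_right 0. 2 * real n * \<eta> powr ((1 + h) / 2) < e / 2"
      using \<open>e > 0\<close> by (intro order_tendstoD) auto
    then obtain \<eta> where \<eta>: "\<eta> > 0" "2 * real n * \<eta> powr ((1 + h) / 2) < e / 2"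
      unfolding eventually_at_right_field by (metis dense)
    define \<kappa> where "\<kappa> = 2 * (2 + 2 * real n) * \<eta> powr (- ((1 - h) / 2))"
    have "(\<lambda>m. \<kappa> * inverse (real (Suc m))) \<longlonglongrightarrow> \<kappa> * 0"
      by (intro tendsto_intros LIMSEQ_inverse_real_of_nat)
    then have "\<forall>\<^sub>F m in sequentially. \<kappa> * inverse (real (Suc m)) < e / 2"
      using \<open>e > 0\<close> by (intro order_tendstoD) auto
    then obtain m where m: "\<kappa> / real (Suc m) < e / 2"
      unfolding eventually_sequentially divide_inverse by blast
    have ne: "w \<in> A (n, m, code n m w)"
      using w n by (simp add: A_def)
    define v where "v = (SOME v. v \<in> A (n, m, code n m w))"
    have v: "v \<in> A (n, m, code n m w)" "v \<in> S"
      using some[of "(n, m, code n m w)"] ne unfolding v_def S_def by auto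
    have vn: "v \<in> Lipschitz_paths n" and code: "code n m v = code n m w"
      using v(1) by (auto simp: A_def)
    have "norm (w (- real k / real (Suc m)) - v (- real k / real (Suc m))) \<le> 2 / real (Suc m)"
      if "k \<le> n * Suc m" for k
    proof -
      let ?s = "- real k / real (Suc m)"
      have "c m (v ?s) = c m (w ?s)"
        using arg_cong[OF code, of "\<lambda>l. l ! k"] that by (simp add: code_def del: upt_Suc)
      then show ?thesis
        using c[of "v ?s" m] c[of "w ?s" m] dist_triangle2[of "w ?s" "v ?s" "from_nat_into Q (c m (w ?s))"]
        by (simp add: dist_norm)
    qed
    from Lipschitz_paths_near[OF vn n _ this]
    have near: "norm (w t - v t) \<le> (2 + 2 * real n) / real (Suc m)" if "t \<le> 0" for t
      using that by (simp add: add_divide_distrib)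
    have "path_norm h (\<lambda>t. w t - v t) \<le> ennreal (2 * real n * \<eta> powr ((1 + h) / 2) +
        2 * ((2 + 2 * real n) / real (Suc m)) * \<eta> powr (- ((1 - h) / 2)))"
    proof (rule path_norm_le_interpolation[OF h _ _ \<eta>(1)])
      fix s t :: real assume st: "s \<le> 0" "t \<le> 0"
      have "norm (w t - v t - (w s - v s)) = norm ((w t - w s) - (v t - v s))"
        by (simp add: algebra_simps)
      also have "\<dots> \<le> real n * \<bar>t - s\<bar> + real n * \<bar>t - s\<bar>"
        using n vn st by (intro order_trans[OF norm_triangle_ineq4 add_mono]) (auto simp: Lipschitz_paths_def)
      finally show "norm (w t - v t - (w s - v s)) \<le> 2 * real n * \<bar>t - s\<bar>" by simp
      show "norm (w t - v t - (w s - v s)) \<le> 2 * ((2 + 2 * real n) / real (Suc m))"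
        using near[of t] near[of s] st norm_triangle_ineq4[of "w t - v t" "w s - v s"] by linarith
    qed auto
    also have "\<dots> < ennreal e"
      using \<eta>(2) m \<open>e > 0\<close> by (intro ennreal_lessI) (auto simp: \<kappa>_def)
    finally show ?thesis
      using v(2) by blast
  qed
  have "\<exists>v\<in>S. path_norm h (\<lambda>t. w t - v t) < ennreal e" if w: "w \<in> path_space h" and "e > 0" for w e
  proof -
    obtain u where u: "u \<in> test_paths" "path_norm h (\<lambda>t. w t - u t) < ennreal (e / 2)"
      using w \<open>e > 0\<close> unfolding path_space_def by (auto dest: spec[of _ "e / 2"])
    obtain v where v: "v \<in> S" "path_norm h (\<lambda>t. u t - v t) < ennreal (e / 2)"
      using approx[OF u(1), of "e / 2"] \<open>e > 0\<close> by auto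
    have "path_norm h (\<lambda>t. w t - v t) \<le> path_norm h (\<lambda>t. w t - u t) + path_norm h (\<lambda>t. u t - v t)"
      by (rule path_norm_diff_triangle)
    also have "\<dots> < ennreal (e / 2) + ennreal (e / 2)"
      using u v by (intro add_strict_mono)
    also have "\<dots> = ennreal e"
      using \<open>e > 0\<close> by (simp flip: ennreal_plus)
    finally show ?thesis
      using v(1) by blast
  qed
  moreover have "countable S"
    unfolding S_def by (intro countable_image) auto
  moreover have "S \<subseteq> path_space h"
    using S_test test_paths_subset by (rule subset_trans)
  ultimately show thesis
    using that by blast
qed

lemma space_path_borel: "space (path_borel h :: 'n::finite path measure) = path_space h"
proof -
  interpret Metric_space "path_space h" "path_dist h :: 'n path \<Rightarrow> _"
    by (rule Metric_space_path_space)
  show ?thesis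
    unfolding path_borel_def path_topology_def
    by (intro space_measure_of) (auto simp: openin_mtopology)
qed

text \<open>By separability, open sets are countable unions of balls, and balls are defined by
  countably many evaluations.\<close>

lemma measurable_path_borelI:
  fixes f :: "'a \<Rightarrow> 'n::finite path"
  assumes f: "f \<in> space M \<rightarrow> path_space h"
    and [measurable]: "\<And>s. s \<le> 0 \<Longrightarrow> (\<lambda>x. f x s) \<in> borel_measurable M"
  shows "f \<in> M \<rightarrow>\<^sub>M path_borel h"
proof -
  interpret Metric_space "path_space h" "path_dist h :: 'n path \<Rightarrow> _"
    by (rule Metric_space_path_space)
  obtain S :: "'n path set" where S: "countable S" "S \<subseteq> path_space h"
    "\<And>w e. w \<in> path_space h \<Longrightarrow> e > 0 \<Longrightarrow> \<exists>v\<in>S. path_norm h (\<lambda>t. w t - v t) < ennreal e"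
    using path_space_separable by blast
  have ball: "f -` mball v r \<inter> space M \<in> sets M" if v: "v \<in> path_space h" for v r
  proof -
    define N where "N = (\<lambda>x. SUP s\<in>(\<rat>::real set). SUP t\<in>(\<rat>::real set).
      ennreal (norm ((f x (- \<bar>t\<bar>) - v (- \<bar>t\<bar>)) - (f x (- \<bar>s\<bar>) - v (- \<bar>s\<bar>))) /
        (sqrt (1 + \<bar>t\<bar> + \<bar>s\<bar>) * \<bar>\<bar>t\<bar> - \<bar>s\<bar>\<bar> powr ((1 - h) / 2))))"
    have "N \<in> borel_measurable M"
      unfolding N_def by (intro borel_measurable_SUP countable_rat) measurable
    then have "{x \<in> space M. N x < ennreal r} \<in> sets M"
      by measurable
    also have "{x \<in> space M. N x < ennreal r} = f -` mball v r \<inter> space M"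
      using f v by (auto simp: N_def in_mball path_dist_less_iff path_norm_countable_SUP Pi_iff)
    finally show ?thesis .
  qed
  show ?thesis
    unfolding path_borel_def
  proof (rule measurable_measure_of)
    show "{U. openin (path_topology h) U} \<subseteq> Pow (path_space h :: 'n path set)"
      unfolding path_topology_def by (auto simp: openin_mtopology)
    show "f \<in> space M \<rightarrow> path_space h" by fact
    fix U :: "'n path set" assume "U \<in> {U. openin (path_topology h) U}"
    then have U: "U \<subseteq> path_space h" "\<And>x. x \<in> U \<Longrightarrow> \<exists>r>0. mball x r \<subseteq> U"
      by (auto simp: path_topology_def openin_mtopology)
    define I where "I = {(v, q). v \<in> S \<and> q \<in> \<rat> \<and> mball v q \<subseteq> U}"
    have "w \<in> (\<Union>(v, q)\<in>I. mball v q)" if wU: "w \<in> U" for w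
    proof -
      obtain r where r: "r > 0" "mball w r \<subseteq> U"
        using U(2)[OF wU] by blast
      have w: "w \<in> path_space h"
        using U wU by auto
      obtain q where q: "q \<in> \<rat>" "0 < q" "q < r / 2"
        using Rats_dense_in_real[of 0 "r / 2"] r by auto
      obtain v where v: "v \<in> S" "path_norm h (\<lambda>t. w t - v t) < ennreal q"
        using S(3)[OF w q(2)] by blast
      have "path_dist h v w < q"
        using path_dist_less_iff[of v w q] v S(2) w by auto
      moreover have "mball v q \<subseteq> mball w r"
        using v S(2) w q \<open>path_dist h v w < q\<close> triangle[of w v] commute[of v w]
        by (force simp: in_mball)
      ultimately show ?thesis
        using v(1) S(2) w q r by (intro UN_I[of "(v, q)"]) (auto simp: I_def in_mball)
    qed
    then have "U = (\<Union>(v, q)\<in>I. mball v q)"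
      by (auto simp: I_def)
    then have "f -` U \<inter> space M = (\<Union>(v, q)\<in>I. f -` mball v q \<inter> space M)"
      by auto
    moreover have "countable I"
      by (rule countable_subset[of _ "S \<times> \<rat>"]) (auto simp: I_def intro: S(1) countable_rat)
    moreover have "f -` mball v q \<inter> space M \<in> sets M" if "(v, q) \<in> I" for v q
      using that S(2) by (intro ball) (auto simp: I_def)
    ultimately show "f -` U \<inter> space M \<in> sets M"
      by (auto intro!: sets.countable_UN')
  qed
qed

end

section \<open>The flow for a fixed noise path\<close>

text \<open>The product of \<open>u\<close> with \<open>exp (- c * s)\<close> is nonincreasing. No
  sign is imposed on \<open>u\<close> or \<open>c\<close>: applied to a negated square with negative
  \<open>c\<close>, the lemma yields lower bounds on distances.\<close>

lemma gronwall:
  fixes u :: "real \<Rightarrow> real"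
  assumes "continuous_on {0..} u" and "\<And>s. s > 0 \<Longrightarrow> (u has_real_derivative u' s) (at s)"
    and "\<And>s. 0 < s \<Longrightarrow> s < t \<Longrightarrow> u' s \<le> c * u s" and "0 \<le> t"
  shows "u t \<le> exp (c * t) * u 0"
proof (cases "t = 0")
  case False
  have "exp (- c * t) * u t \<le> exp (- c * 0) * u 0"
  proof (rule DERIV_nonpos_imp_decreasing_open[where f = "\<lambda>s. exp (- c * s) * u s"])
    fix s assume s: "0 < s" "s < t"
    have "((\<lambda>s. exp (- c * s) * u s) has_real_derivative exp (- c * s) * (u' s - c * u s)) (at s)"
      by (auto intro!: derivative_eq_intros assms(2) s simp: algebra_simps)
    moreover have "exp (- c * s) * (u' s - c * u s) \<le> 0"
      using assms(3)[OF s] by (simp add: mult_le_0_iff)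
    ultimately show "\<exists>y. ((\<lambda>s. exp (- c * s) * u s) has_real_derivative y) (at s) \<and> y \<le> 0"
      by blast
    next
    show "continuous_on {0..t} (\<lambda>s. exp (- c * s) * u s)"
      by (intro continuous_intros continuous_on_subset[OF assms(1)]) auto
  qed (use False assms(4) in simp)
  then have "exp (c * t) * (exp (- c * t) * u t) \<le> exp (c * t) * u 0"
    by simp
  then show ?thesis
    by (simp flip: mult.assoc exp_add)
qed simp

lemma at_within_Ici_pos: "t > 0 \<Longrightarrow> at t within {0..} = at (t :: real)"
  by (rule at_within_interior) (auto simp: interior_Ici[of "-1"])

text \<open>\<open>noise_0\<close> makes the driving noise vanish at time 0, so that
  \<open>\<Phi> 0 w\<close> is the identity.\<close>

locale additive_noise_flow =
  fixes H C3 :: real and D :: "'n::finite path \<Rightarrow> 'n path" and F :: "real ^ 'n \<Rightarrow> real ^ 'n"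
    and \<sigma> :: "real ^ 'n ^ 'n"
    and \<Phi> :: "real \<Rightarrow> 'n path \<times> 'n path \<Rightarrow> real ^ 'n \<Rightarrow> real ^ 'n"
  assumes drift: "drift_conditions H F C3" and flow: "sde_flow H D F \<sigma> \<Phi>"
    and noise_0: "w \<in> path_space H \<Longrightarrow> D w 0 = 0"
begin

lemma C3_pos: "C3 > 0"
  using drift by (simp add: drift_conditions_def)

lemma one_sided_Lipschitz: "(F x - F y) \<bullet> (x - y) \<le> C3 * (norm (x - y))\<^sup>2"
  using drift unfolding drift_conditions_def by (metis min.boundedE)

lemma continuous_drift: "continuous_on S F"
  using drift unfolding drift_conditions_def
  by (meson continuous_at_imp_continuous_on differentiable_imp_continuous_within)

text \<open>The polynomial bound on the derivative is uniform on a ball. The one-sided Lipschitz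
  condition controls distances of solutions from above; this two-sided one controls them from
  below.\<close>

lemma local_Lipschitz:
  obtains L where "L \<ge> 0" "\<And>x y. norm x \<le> \<rho> \<Longrightarrow> norm y \<le> \<rho> \<Longrightarrow> norm (F x - F y) \<le> L * norm (x - y)"
proof -
  have diff: "(F has_derivative frechet_derivative F (at x)) (at x)" for x
    using drift unfolding drift_conditions_def by (metis frechet_derivative_works)
  from drift obtain CF N where CF: "CF > 0" "N \<ge> 1"
    "\<And>x. onorm (frechet_derivative F (at x)) \<le> CF * (1 + norm x) powr N"
    unfolding drift_conditions_def by metis
  define L where "L = CF * (1 + \<bar>\<rho>\<bar>) powr N"
  have "norm (F x - F y) \<le> L * norm (x - y)" if "norm x \<le> \<rho>" "norm y \<le> \<rho>" for x y
  proof (rule differentiable_bound[of "cball 0 \<rho>" F "\<lambda>x. frechet_derivative F (at x)"])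
    fix z :: "real ^ 'n" assume "z \<in> cball 0 \<rho>"
    then have "(1 + norm z) powr N \<le> (1 + \<bar>\<rho>\<bar>) powr N"
      using CF by (intro powr_mono2) auto
    then show "onorm (frechet_derivative F (at z)) \<le> L"
      using CF(3)[of z] CF(1) unfolding L_def by (meson less_imp_le mult_left_mono order_trans)
  qed (use that diff in \<open>auto intro: has_derivative_at_withinI\<close>)
  moreover have "L \<ge> 0"
    using CF by (simp add: L_def)
  ultimately show thesis
    using that by blast
qed

context
  fixes w :: "'n path \<times> 'n path"
  assumes w: "w \<in> path_space H \<times> path_space H"
begin

lemma continuous_flow: "continuous_on {0..} (\<lambda>t. \<Phi> t w x)"
  using flow w unfolding sde_flow_def by blast

lemma flow_0 [simp]: "\<Phi> 0 w x = x"
proof -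
  obtain wm wp where w_eq: "w = (wm, wp)" and wm: "wm \<in> path_space H" and "wp 0 = 0"
    using w by (auto simp: path_space_def)
  have "path_concat 0 w = wm"
    using wm \<open>wp 0 = 0\<close> by (auto simp: w_eq path_concat_def path_space_def fun_eq_iff)
  moreover have "\<Phi> 0 w x = x + integral {0..0} (\<lambda>s. F (\<Phi> s w x)) + \<sigma> *v driving_noise D 0 w"
    using flow w unfolding sde_flow_def by auto
  ultimately show ?thesis
    using wm by (simp add: driving_noise_def noise_0)
qed

text \<open>The additive noise cancels in the difference of two solutions, which is therefore
  differentiable although each solution follows a rough path. At time 0 the derivative is
  one-sided.\<close>

lemma flow_difference_has_derivative:
  assumes "t \<ge> 0"
  shows "((\<lambda>t. \<Phi> t w x - \<Phi> t w y) has_vector_derivative F (\<Phi> t w x) - F (\<Phi> t w y))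
    (at t within {0..})"
proof -
  have cont: "continuous_on {0..} (\<lambda>s. F (\<Phi> s w x))" for x
    by (rule continuous_on_compose2[OF continuous_drift continuous_flow]) auto
  let ?I = "\<lambda>x t. integral {0..t} (\<lambda>s. F (\<Phi> s w x))"
  have "(?I x has_vector_derivative F (\<Phi> t w x)) (at t within {0..t+1})" for x
    using assms by (intro integral_has_vector_derivative continuous_on_subset[OF cont]) auto
  moreover have "at t within {0..t+1} = at t within {0..}"
    using assms by (intro at_within_nhd[of t "{..<t+1}"]) auto
  ultimately have "(?I x has_vector_derivative F (\<Phi> t w x)) (at t within {0..})" for x
    by simp
  then have 1: "((\<lambda>t. x - y + (?I x t - ?I y t)) has_vector_derivative F (\<Phi> t w x) - F (\<Phi> t w y))
      (at t within {0..})"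
    by (auto intro!: derivative_eq_intros)
  have "\<Phi> s w z = z + ?I z s + \<sigma> *v driving_noise D s w" if "s \<ge> 0" for s z
    using flow w that unfolding sde_flow_def by blast
  then have "\<Phi> s w x - \<Phi> s w y = x - y + (?I x s - ?I y s)" if "s \<in> {0..}" for s
    using that by (simp only: atLeast_iff) (simp add: algebra_simps)
  then show ?thesis
    using 1 assms by (intro has_vector_derivative_transform[OF _ _ 1]) auto
qed

lemma distance_has_derivative:
  assumes "t \<ge> 0"
  shows "((\<lambda>t. (norm (\<Phi> t w x - \<Phi> t w y))\<^sup>2) has_real_derivative
    2 * ((F (\<Phi> t w x) - F (\<Phi> t w y)) \<bullet> (\<Phi> t w x - \<Phi> t w y))) (at t within {0..})"
  unfolding power2_norm_eq_inner has_real_derivative_iff_has_vector_derivative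
  by (rule has_vector_derivative_eq_rhs,
      rule bounded_bilinear.has_vector_derivative[OF bounded_bilinear_inner
        flow_difference_has_derivative[OF assms] flow_difference_has_derivative[OF assms]])
     (simp add: inner_commute)

lemma distance_has_derivative_at:
  assumes "t > 0"
  shows "((\<lambda>t. (norm (\<Phi> t w x - \<Phi> t w y))\<^sup>2) has_real_derivative
    2 * ((F (\<Phi> t w x) - F (\<Phi> t w y)) \<bullet> (\<Phi> t w x - \<Phi> t w y))) (at t)"
  using distance_has_derivative[of t x y] assms at_within_Ici_pos[of t] by simp

lemma continuous_distance: "continuous_on {0..} (\<lambda>t. (norm (\<Phi> t w x - \<Phi> t w y))\<^sup>2)"
  by (intro continuous_intros continuous_flow)

lemma flow_Lipschitz:
  assumes "t \<ge> 0"
  shows "norm (\<Phi> t w x - \<Phi> t w y) \<le> exp (C3 * t) * norm (x - y)"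
proof -
  have "(norm (\<Phi> t w x - \<Phi> t w y))\<^sup>2 \<le> exp ((2 * C3) * t) * (norm (\<Phi> 0 w x - \<Phi> 0 w y))\<^sup>2"
    by (rule gronwall[OF continuous_distance distance_has_derivative_at _ assms])
       (use one_sided_Lipschitz in auto)
  also have "\<dots> = (exp (C3 * t) * norm (x - y))\<^sup>2"
    by (simp add: power_mult_distrib exp_double[symmetric] mult.assoc)
  finally show ?thesis
    by (rule power2_le_imp_le) simp
qed

lemma continuous_flow_space: "t \<ge> 0 \<Longrightarrow> continuous_on UNIV (\<Phi> t w)"
  by (rule lipschitz_on_continuous_on[of "exp (C3 * t)"], rule lipschitz_onI)
     (auto simp: dist_norm flow_Lipschitz)

text \<open>Backward uniqueness: up to time \<open>t\<close> both solutions stay in a ball on which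
  \<open>F\<close> is Lipschitz, so their distance decays at most exponentially and cannot reach
  0.\<close>

lemma inj_flow:
  assumes "t \<ge> 0"
  shows "inj (\<Phi> t w)"
proof (rule injI, rule ccontr)
  fix x y assume eq: "\<Phi> t w x = \<Phi> t w y" and "x \<noteq> y"
  have "bounded ((\<lambda>s. \<Phi> s w x) ` {0..t} \<union> (\<lambda>s. \<Phi> s w y) ` {0..t})"
    unfolding bounded_Un by (intro conjI compact_imp_bounded compact_continuous_image
        continuous_on_subset[OF continuous_flow]) auto
  then obtain \<rho> where \<rho>: "\<And>s. 0 \<le> s \<Longrightarrow> s \<le> t \<Longrightarrow> norm (\<Phi> s w x) \<le> \<rho> \<and> norm (\<Phi> s w y) \<le> \<rho>"
    unfolding bounded_iff by (metis (no_types, lifting) UnCI atLeastAtMost_iff imageI)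
  obtain L where L: "L \<ge> 0"
    "\<And>x y. norm x \<le> \<rho> \<Longrightarrow> norm y \<le> \<rho> \<Longrightarrow> norm (F x - F y) \<le> L * norm (x - y)"
    using local_Lipschitz[of \<rho>] by blast
  \<comment> \<open>Gronwall for the negated square with rate \<open>- 2 * L\<close>, which is a
    lower bound for the square itself.\<close>
  have "- (norm (\<Phi> t w x - \<Phi> t w y))\<^sup>2 \<le> exp ((- 2 * L) * t) * - (norm (\<Phi> 0 w x - \<Phi> 0 w y))\<^sup>2"
  proof (rule gronwall[OF _ _ _ assms])
    show "((\<lambda>t. - (norm (\<Phi> t w x - \<Phi> t w y))\<^sup>2) has_real_derivative
      - (2 * ((F (\<Phi> s w x) - F (\<Phi> s w y)) \<bullet> (\<Phi> s w x - \<Phi> s w y)))) (at s)" if "s > 0" for s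
      by (intro DERIV_minus distance_has_derivative_at that)
    show "- (2 * ((F (\<Phi> s w x) - F (\<Phi> s w y)) \<bullet> (\<Phi> s w x - \<Phi> s w y)))
      \<le> (- 2 * L) * - (norm (\<Phi> s w x - \<Phi> s w y))\<^sup>2" if s: "0 < s" "s < t" for s
    proof -
      let ?z = "\<Phi> s w x - \<Phi> s w y" and ?d = "F (\<Phi> s w x) - F (\<Phi> s w y)"
      have "- (?d \<bullet> ?z) \<le> norm ?d * norm ?z"
        using Cauchy_Schwarz_ineq2[of ?d ?z] by linarith
      also have "\<dots> \<le> L * norm ?z * norm ?z"
        using \<rho>[of s] s by (intro mult_right_mono L) auto
      finally show ?thesis
        by (simp add: power2_eq_square mult.assoc)
    qed
  qed (intro continuous_intros continuous_distance)
  then show False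
    using eq \<open>x \<noteq> y\<close> by (simp add: mult_le_0_iff)
qed

text \<open>The Lyapunov function \<open>ln (1 + \<bar>x - y\<bar>\<^sup>2 / \<epsilon>)\<close> interpolates between \<open>0\<close> on the
  diagonal and \<open>2 ln \<bar>x - y\<bar> + const\<close> away from it, so that no integrability of the logarithmic
  distance is required.\<close>

lemma log_distance_has_derivative:
  assumes "t \<ge> 0" "\<epsilon> > 0"
  shows "((\<lambda>t. ln (1 + (norm (\<Phi> t w x - \<Phi> t w y))\<^sup>2 / \<epsilon>)) has_real_derivative
    2 * ((F (\<Phi> t w x) - F (\<Phi> t w y)) \<bullet> (\<Phi> t w x - \<Phi> t w y)) /
      (\<epsilon> + (norm (\<Phi> t w x - \<Phi> t w y))\<^sup>2)) (at t within {0..})"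
proof -
  have pos: "1 + (norm (\<Phi> t w x - \<Phi> t w y))\<^sup>2 / \<epsilon> > 0"
    using assms by (intro add_pos_nonneg) auto
  have "((\<lambda>t. 1 + (norm (\<Phi> t w x - \<Phi> t w y))\<^sup>2 / \<epsilon>) has_real_derivative
      2 * ((F (\<Phi> t w x) - F (\<Phi> t w y)) \<bullet> (\<Phi> t w x - \<Phi> t w y)) / \<epsilon>) (at t within {0..})"
    using DERIV_add[OF DERIV_const DERIV_cdivide[OF distance_has_derivative[OF assms(1)]]] by simp
  from DERIV_chain2[where f = ln, OF DERIV_ln_divide[OF pos] this] show ?thesis
    using assms pos by (simp add: divide_simps)
qed

text \<open>With \<open>d\<close> the squared distance, the derivative is at most
  \<open>2 * C3 * d / (\<epsilon> + d)\<close>, hence at most \<open>2 * C3\<close> whatever the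
  points and \<open>\<epsilon>\<close>. This makes the integrands for Fatou's lemma
  nonnegative.\<close>

lemma log_distance_increment_le:
  assumes "t \<ge> 0" "\<epsilon> > 0"
  shows "ln (1 + (norm (\<Phi> t w x - \<Phi> t w y))\<^sup>2 / \<epsilon>) \<le> ln (1 + (norm (x - y))\<^sup>2 / \<epsilon>) + 2 * C3 * t"
proof (cases "t = 0")
  case False
  let ?f = "\<lambda>t. ln (1 + (norm (\<Phi> t w x - \<Phi> t w y))\<^sup>2 / \<epsilon>) - 2 * C3 * t"
  have "?f t \<le> ?f 0"
  proof (rule DERIV_nonpos_imp_decreasing_open[where f = ?f])
    fix s assume s: "0 < s" "s < t"
    let ?z = "\<Phi> s w x - \<Phi> s w y" and ?d = "F (\<Phi> s w x) - F (\<Phi> s w y)"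
    have "(?f has_real_derivative 2 * (?d \<bullet> ?z) / (\<epsilon> + (norm ?z)\<^sup>2) - 2 * C3) (at s within {0..})"
      using s assms by (intro DERIV_diff log_distance_has_derivative) (auto intro!: derivative_eq_intros)
    then have "(?f has_real_derivative 2 * (?d \<bullet> ?z) / (\<epsilon> + (norm ?z)\<^sup>2) - 2 * C3) (at s)"
      using s at_within_Ici_pos[of s] by simp
    moreover have "?d \<bullet> ?z \<le> C3 * (\<epsilon> + (norm ?z)\<^sup>2)"
      using one_sided_Lipschitz[of "\<Phi> s w x" "\<Phi> s w y"] C3_pos assms by (simp add: distrib_left add.commute pos_add_strict less_imp_le add_increasing)
    then have "2 * (?d \<bullet> ?z) / (\<epsilon> + (norm ?z)\<^sup>2) - 2 * C3 \<le> 0"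
      using assms by (simp add: divide_le_eq add_pos_nonneg)
    ultimately show "\<exists>y. (?f has_real_derivative y) (at s) \<and> y \<le> 0"
      by blast
  next
    have "1 + (norm (\<Phi> s w x - \<Phi> s w y))\<^sup>2 / \<epsilon> \<noteq> 0" for s
      using assms(2) by (smt (verit) divide_nonneg_pos zero_le_power2)
    then show "continuous_on {0..t} ?f"
      using assms by (auto intro!: continuous_intros continuous_on_subset[OF continuous_flow])
  qed (use False assms in auto)
  then show ?thesis
    by simp
qed simp

text \<open>The right derivative at time 0, taken along the steps \<open>1 / (n + 1)\<close>,
  because Fatou's lemma works with sequences.\<close>

lemma log_distance_difference_quotient:
  assumes "\<epsilon> > 0"
  shows "(\<lambda>n. real (Suc n) * (ln (1 + (norm (\<Phi> (1 / real (Suc n)) w x - \<Phi> (1 / real (Suc n)) w y))\<^sup>2 / \<epsilon>)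
      - ln (1 + (norm (x - y))\<^sup>2 / \<epsilon>)))
    \<longlonglongrightarrow> 2 * ((F x - F y) \<bullet> (x - y)) / (\<epsilon> + (norm (x - y))\<^sup>2)"
proof -
  let ?f = "\<lambda>t. ln (1 + (norm (\<Phi> t w x - \<Phi> t w y))\<^sup>2 / \<epsilon>)"
  have "((\<lambda>t. (?f t - ?f 0) / (t - 0)) \<longlongrightarrow>
      2 * ((F x - F y) \<bullet> (x - y)) / (\<epsilon> + (norm (x - y))\<^sup>2)) (at 0 within {0..})"
    using log_distance_has_derivative[of 0 \<epsilon> x y] assms
    by (simp add: has_field_derivative_iff)
  moreover have "filterlim (\<lambda>n. 1 / real (Suc n)) (at 0 within {0..}) sequentially"
    unfolding filterlim_at using LIMSEQ_inverse_real_of_nat by (auto simp: inverse_eq_divide)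
  ultimately have "(\<lambda>n. (?f (1 / real (Suc n)) - ?f 0) / (1 / real (Suc n) - 0)) \<longlonglongrightarrow>
      2 * ((F x - F y) \<bullet> (x - y)) / (\<epsilon> + (norm (x - y))\<^sup>2)"
    by (rule filterlim_compose)
  then show ?thesis
    by (simp add: mult.commute)
qed

end
end

section \<open>Stationarity and the zero-one law\<close>

locale stationary_noise_flow = additive_noise_flow H C3 D F \<sigma> \<Phi>
  for H C3 and D :: "'n::finite path \<Rightarrow> 'n path" and F \<sigma> \<Phi> +
  fixes P :: "'n path measure" and \<mu> Bt K
  assumes H: "0 < H" "H < 1"
    and wiener: "wiener_measure H P"
    and invariant: "invariant_measure H P \<Phi> \<mu>"
    and disintegration: "flow_disintegration H P \<Phi> \<mu> Bt K"
begin

sublocale P: prob_space P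
  using wiener by (simp add: wiener_measure_def brownian_motion_def)

lemma sets_P: "sets P = sets (path_borel H)"
  using wiener by (simp add: wiener_measure_def)

lemma space_P: "space P = path_space H"
  using sets_eq_imp_space_eq[OF sets_P] space_path_borel[OF H] by simp

lemma measurable_eval [measurable]:
  assumes "s \<le> 0" shows "(\<lambda>w. w s) \<in> borel_measurable P"
proof -
  have "(\<lambda>w. w (- (- s))) \<in> borel_measurable P"
    using wiener assms unfolding wiener_measure_def brownian_motion_def by (meson neg_0_le_iff_le)
  then show ?thesis by simp
qed

lemma Bt_sets [measurable]: "Bt \<in> sets P"
  using disintegration by (simp add: flow_disintegration_def)

lemma Bt_subset: "Bt \<subseteq> path_space H"
  using sets.sets_into_space[OF Bt_sets] space_P by simp

lemma AE_Bt: "AE wm in P. wm \<in> Bt"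
  using disintegration P.prob_eq_1[of Bt] Bt_sets by (simp add: flow_disintegration_def P.emeasure_eq_measure)

lemma path_concat_Bt:
  "wm \<in> Bt \<Longrightarrow> wp \<in> path_space H \<Longrightarrow> t \<ge> 0 \<Longrightarrow> path_concat t (wm, wp) \<in> Bt"
  using disintegration by (simp add: flow_disintegration_def)

lemma distr_kernel_flow:
  "wm \<in> Bt \<Longrightarrow> wp \<in> path_space H \<Longrightarrow> t \<ge> 0 \<Longrightarrow>
    distr (K wm) borel (\<Phi> t (wm, wp)) = K (path_concat t (wm, wp))"
  using disintegration by (simp add: flow_disintegration_def)

lemma prob_kernel: "wm \<in> path_space H \<Longrightarrow> prob_space (K wm)"
  and sets_kernel: "wm \<in> path_space H \<Longrightarrow> sets (K wm) = sets borel"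
  using disintegration by (auto simp: flow_disintegration_def)

lemma space_kernel: "wm \<in> path_space H \<Longrightarrow> space (K wm) = UNIV"
  using sets_eq_imp_space_eq[OF sets_kernel] by simp

lemma measurable_kernel [measurable]: "K \<in> P \<rightarrow>\<^sub>M subprob_algebra borel"
proof (rule measurable_subprob_algebra)
  show "subprob_space (K a)" if "a \<in> space P" for a
    using prob_kernel that space_P by (auto intro: prob_space_imp_subprob_space)
  show "(\<lambda>a. emeasure (K a) A) \<in> borel_measurable P" if "A \<in> sets borel" for A
    using disintegration that by (simp add: flow_disintegration_def)
qed (use sets_kernel space_P in auto)

text \<open>\<open>path_concat\<close> is only known to stay in the path space when the past lies in \<open>Bt\<close>.\<close>

definition history :: "real \<Rightarrow> 'n path \<times> 'n path \<Rightarrow> 'n path" where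
  "history t z = (if fst z \<in> Bt then path_concat t z else fst z)"

lemma history_eq: "wm \<in> Bt \<Longrightarrow> history t (wm, wp) = path_concat t (wm, wp)"
  by (simp add: history_def)

text \<open>It suffices to evaluate at one time, and there the concatenated path is a difference of
  evaluations of the two given paths.\<close>

lemma measurable_history [measurable]:
  assumes "t \<ge> 0"
  shows "history t \<in> P \<Otimes>\<^sub>M P \<rightarrow>\<^sub>M P"
proof -
  have "history t \<in> P \<Otimes>\<^sub>M P \<rightarrow>\<^sub>M path_borel H"
  proof (rule measurable_path_borelI[OF H])
    show "history t \<in> space (P \<Otimes>\<^sub>M P) \<rightarrow> path_space H"
      by (auto simp: history_def space_pair_measure space_P
          intro: subsetD[OF Bt_subset path_concat_Bt[OF _ _ assms]])
    fix s :: real assume "s \<le> 0"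
    then have "history t z s = (if fst z \<in> Bt then
        (if - t \<le> s then snd z (- s - t) else fst z (s + t)) - snd z (- t) else fst z s)" for z
      by (auto simp: history_def path_concat_def case_prod_unfold)
    moreover have ev: "(\<lambda>z. fst z u) \<in> borel_measurable (P \<Otimes>\<^sub>M P)"
      "(\<lambda>z. snd z u) \<in> borel_measurable (P \<Otimes>\<^sub>M P)" if "u \<le> 0" for u
      using measurable_compose[OF measurable_fst measurable_eval[OF that]]
        measurable_compose[OF measurable_snd measurable_eval[OF that]] by auto
    have inner: "(\<lambda>z. if - t \<le> s then snd z (- s - t) else fst z (s + t)) \<in> borel_measurable (P \<Otimes>\<^sub>M P)"
      by (cases "- t \<le> s") (simp_all add: ev)
    have "(\<lambda>z. if fst z \<in> Bt then (if - t \<le> s then snd z (- s - t) else fst z (s + t)) - snd z (- t)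
        else fst z s) \<in> borel_measurable (P \<Otimes>\<^sub>M P)"
      using assms \<open>s \<le> 0\<close> by (intro measurable_If borel_measurable_diff inner ev) (auto, measurable)
    ultimately show "(\<lambda>z. history t z s) \<in> borel_measurable (P \<Otimes>\<^sub>M P)"
      by simp
  qed
  then show ?thesis
    using measurable_cong_sets[OF refl sets_P] by blast
qed

text \<open>This is the invariance of \<open>\<mu>\<close>, read off on the noise coordinate.\<close>

lemma distr_history:
  assumes "t \<ge> 0"
  shows "distr (P \<Otimes>\<^sub>M P) P (history t) = P"
proof (rule measure_eqI)
  fix E assume "E \<in> sets (distr (P \<Otimes>\<^sub>M P) P (history t))"
  then have E [measurable]: "E \<in> sets P" by simp
  have sets_\<mu>: "sets \<mu> = sets (borel \<Otimes>\<^sub>M P)"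
    using invariant sets_pair_measure_cong[OF refl[of "sets (borel :: (real ^ 'n) measure)"] sets_P]
    by (simp add: invariant_measure_def)
  have marginal: "distr \<mu> P snd = P"
    using invariant distr_cong[OF refl sets_P[symmetric], of \<mu> snd snd] by (simp add: invariant_measure_def sets_P)
  have snd [measurable]: "snd \<in> \<mu> \<rightarrow>\<^sub>M P"
    using measurable_snd[of borel P] measurable_cong_sets[OF sets_\<mu> refl] by blast
  have G: "UNIV \<times> E \<in> sets \<mu>"
    unfolding sets_\<mu> by simp
  note [measurable] = measurable_history[OF assms]
  define h where "h wm = (\<integral>\<^sup>+ wp. indicator E (history t (wm, wp)) \<partial>P)" for wm
  have [measurable]: "h \<in> borel_measurable P"
    unfolding h_def by measurable
  have "emeasure (distr (P \<Otimes>\<^sub>M P) P (history t)) E = (\<integral>\<^sup>+ z. indicator E (history t z) \<partial>(P \<Otimes>\<^sub>M P))"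
    by (simp flip: nn_integral_indicator add: nn_integral_distr)
  also have "\<dots> = (\<integral>\<^sup>+ wm. h wm \<partial>P)"
    unfolding h_def by (subst P.nn_integral_fst[symmetric]) auto
  also have "\<dots> = (\<integral>\<^sup>+ z. h (snd z) \<partial>\<mu>)"
    using nn_integral_distr[OF snd, of h] by (simp add: marginal)
  also have "\<dots> = (\<integral>\<^sup>+ z. transition P \<Phi> t z (UNIV \<times> E) \<partial>\<mu>)"
  proof (rule nn_integral_cong_AE)
    have "AE wm in distr \<mu> P snd. wm \<in> Bt"
      unfolding marginal by (rule AE_Bt)
    then have "AE z in \<mu>. snd z \<in> Bt"
      by (rule AE_distrD[OF snd])
    then show "AE z in \<mu>. h (snd z) = transition P \<Phi> t z (UNIV \<times> E)"
      by eventually_elim (auto simp: h_def transition_def history_eq indicator_def case_prod_unfold)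
  qed
  also have "\<dots> = emeasure \<mu> (UNIV \<times> E)"
    using invariant assms G by (simp add: invariant_measure_def)
  also have "UNIV \<times> E = snd -` E \<inter> space \<mu>"
    using sets_eq_imp_space_eq[OF sets_\<mu>] sets.sets_into_space[OF E] by (auto simp: space_pair_measure)
  also have "emeasure \<mu> \<dots> = emeasure P E"
    using emeasure_distr[OF snd E] by (simp add: marginal)
  finally show "emeasure (distr (P \<Otimes>\<^sub>M P) P (history t)) E = emeasure P E" .
qed simp

sublocale PP: pair_prob_space P P ..

lemma AE_history:
  assumes "t \<ge> 0" "AE w in P. Q w"
  shows "AE z in P \<Otimes>\<^sub>M P. Q (history t z)"
  by (rule AE_distrD[OF measurable_history[OF assms(1)]]) (unfold distr_history[OF assms(1)], fact assms(2))

lemma AE_past: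
  assumes "AE w in P. Q w"
  shows "AE z in P \<Otimes>\<^sub>M P. Q (fst z)"
  by (rule AE_distrD[OF measurable_fst]) (unfold P.distr_pair_fst, fact assms)

lemma nn_integral_history:
  assumes "t \<ge> 0" and [measurable]: "f \<in> borel_measurable P"
  shows "(\<integral>\<^sup>+ z. f (history t z) \<partial>(P \<Otimes>\<^sub>M P)) = (\<integral>\<^sup>+ w. f w \<partial>P)"
  using nn_integral_distr[OF measurable_history[OF assms(1)], of f] by (simp add: distr_history[OF assms(1)])

lemma nn_integral_past:
  assumes [measurable]: "f \<in> borel_measurable P"
  shows "(\<integral>\<^sup>+ z. f (fst z) \<partial>(P \<Otimes>\<^sub>M P)) = (\<integral>\<^sup>+ w. f w \<partial>P)"
  using nn_integral_distr[OF measurable_fst[of P P], of f] by (simp add: P.distr_pair_fst)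

section \<open>Cylinder sets and the zero-one law\<close>

definition cylinders :: "'n path set set" where
  "cylinders = {{w \<in> path_space H. \<forall>s\<in>I. w s \<in> A s} | I A.
     finite I \<and> I \<subseteq> {..0} \<and> (\<forall>s. A s \<in> sets borel)}"

lemma cylinder_sets: "X \<in> cylinders \<Longrightarrow> X \<in> sets P"
proof -
  assume "X \<in> cylinders"
  then obtain I A where X: "X = {w \<in> path_space H. \<forall>s\<in>I. w s \<in> A s}"
    and I: "finite I" "I \<subseteq> {..0}" and A: "\<And>s. A s \<in> sets borel"
    unfolding cylinders_def by blast
  have "{w \<in> space P. w s \<in> A s} \<in> sets P" if "s \<in> I" for s
    using measurable_sets[OF measurable_eval A, of s s] that I
    by (auto simp: vimage_def Int_def conj_commute)
  then show "X \<in> sets P"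
    unfolding X space_P[symmetric] using I(1) by (intro sets.sets_Collect_finite_All) auto
qed

text \<open>That Borel sets lie in the cylinder sigma-algebra amounts to measurability of the
  identity map, which \<open>measurable_path_borelI\<close> reduces to evaluations.\<close>

lemma sets_P_cylinders: "sets P = sigma_sets (path_space H) cylinders"
proof
  have sub: "cylinders \<subseteq> Pow (path_space H)"
    by (auto simp: cylinders_def)
  have id: "(\<lambda>w. w) \<in> sigma (path_space H) cylinders \<rightarrow>\<^sub>M path_borel H"
  proof (rule measurable_path_borelI[OF H])
    fix s :: real assume "s \<le> 0"
    show "(\<lambda>w. w s) \<in> borel_measurable (sigma (path_space H) cylinders)"
    proof (rule measurableI)
      fix A :: "(real ^ 'n) set" assume "A \<in> sets borel"
      then have "(\<lambda>w. w s) -` A \<inter> path_space H \<in> cylinders"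
        using \<open>s \<le> 0\<close> unfolding cylinders_def by (auto intro!: exI[of _ "{s}"] exI[of _ "\<lambda>_. A"])
      then show "(\<lambda>w. w s) -` A \<inter> space (sigma (path_space H) cylinders) \<in> sets (sigma (path_space H) cylinders)"
        using sub by (simp add: space_measure_of)
    qed simp
  qed (use sub in \<open>simp add: space_measure_of\<close>)
  show "sets P \<subseteq> sigma_sets (path_space H) cylinders"
  proof (intro subsetI)
    fix X assume "X \<in> sets P"
    then have "X \<in> sets (path_borel H)" "X \<subseteq> path_space H"
      using sets.sets_into_space[of X P] by (auto simp: sets_P[symmetric] space_P)
    then show "X \<in> sigma_sets (path_space H) cylinders"
      using measurable_sets[OF id, of X] sub by (simp add: Int_absorb2)
  qed
  show "sigma_sets (path_space H) cylinders \<subseteq> sets P"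
    using sets.sigma_sets_subset[of cylinders P] cylinder_sets by (auto simp: space_P)
qed

lemma Int_stable_cylinders: "Int_stable cylinders"
proof (rule Int_stableI)
  fix X Y assume "X \<in> cylinders" "Y \<in> cylinders"
  then obtain I A J B where
    X: "X = {w \<in> path_space H. \<forall>s\<in>I. w s \<in> A s}" "finite I" "I \<subseteq> {..0}" "\<And>s. A s \<in> sets borel" and
    Y: "Y = {w \<in> path_space H. \<forall>s\<in>J. w s \<in> B s}" "finite J" "J \<subseteq> {..0}" "\<And>s. B s \<in> sets borel"
    unfolding cylinders_def by blast
  show "X \<inter> Y \<in> cylinders"
    unfolding cylinders_def mem_Collect_eq
  proof (intro exI[of _ "I \<union> J"]
      exI[of _ "\<lambda>s. (if s \<in> I then A s else UNIV) \<inter> (if s \<in> J then B s else UNIV)"] conjI)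
    show "X \<inter> Y = {w \<in> path_space H. \<forall>s\<in>I \<union> J.
        w s \<in> (if s \<in> I then A s else UNIV) \<inter> (if s \<in> J then B s else UNIV)}"
      unfolding X(1) Y(1) by auto
  qed (use X Y in auto)
qed

text \<open>An event that does not depend on the recent past is independent of every
  cylinder, hence of itself.\<close>

lemma zero_one_law:
  assumes E [measurable]: "E \<in> sets P"
    and tail: "\<And>t wm wp. t \<ge> 0 \<Longrightarrow> wm \<in> Bt \<Longrightarrow> wp \<in> path_space H \<Longrightarrow>
      path_concat t (wm, wp) \<in> E \<longleftrightarrow> wm \<in> E"
  shows "emeasure P E = 0 \<or> emeasure P E = 1"
proof -
  have indep: "emeasure P (E \<inter> X) = emeasure P E * emeasure P X" if X_cyl: "X \<in> cylinders" for X
  proof -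
    obtain I A where X: "X = {w \<in> path_space H. \<forall>s\<in>I. w s \<in> A s}"
      and I: "finite I" "I \<subseteq> {..0}" and A [measurable]: "\<And>s. A s \<in> sets borel"
      using X_cyl unfolding cylinders_def by blast
    have [measurable]: "X \<in> sets P"
      using X_cyl by (rule cylinder_sets)
    \<comment> \<open>The sum of the absolute values is a convenient time beyond all of
      \<open>I\<close>. After concatenation over time \<open>T\<close> the values on
      \<open>I\<close> depend on \<open>wp\<close> alone.\<close>
    obtain T where T: "T \<ge> 0" "\<And>s. s \<in> I \<Longrightarrow> - T \<le> s"
    proof
      show "(\<Sum>s\<in>I. \<bar>s\<bar>) \<ge> 0" by (simp add: sum_nonneg)
      show "- (\<Sum>s\<in>I. \<bar>s\<bar>) \<le> s" if "s \<in> I" for s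
        using member_le_sum[of s I abs] that I by auto
    qed
    \<comment> \<open>The condition \<open>X\<close> read off the future path: for
      \<open>- T \<le> s\<close> the concatenated path takes the value
      \<open>wp (- s - T) - wp (- T)\<close> at \<open>s\<close>.\<close>
    define Y where "Y = {w \<in> space P. \<forall>s\<in>I. w (- s - T) - w (- T) \<in> A s}"
    have Y [measurable]: "Y \<in> sets P"
    proof -
      have "(\<lambda>w. w (- s - T) - w (- T)) -` A s \<inter> space P \<in> sets P" if "s \<in> I" for s
        using T(1) T(2)[OF that] by (intro measurable_sets[OF _ A] borel_measurable_diff measurable_eval) auto
      then have "{w \<in> space P. w (- s - T) - w (- T) \<in> A s} \<in> sets P" if "s \<in> I" for s
        using that by (simp add: vimage_def Int_def conj_commute)
      then show ?thesis
        unfolding Y_def using I(1) by (intro sets.sets_Collect_finite_All) auto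
    qed
    have iff: "history T (wm, wp) \<in> X \<longleftrightarrow> wp \<in> Y" if "wm \<in> Bt" "wp \<in> path_space H" for wm wp
      using path_concat_Bt[OF that T(1)] Bt_subset that I T(2)
      by (auto simp: history_eq X Y_def space_P path_concat_def subset_iff)
    \<comment> \<open>Stated for any event that ignores the recent past, because it is used twice:
      the whole space gives \<open>emeasure P X = emeasure P Y\<close>, and \<open>E\<close> then
      gives independence.\<close>
    have *: "emeasure P (E' \<inter> X) = emeasure P E' * emeasure P Y" if [measurable]: "E' \<in> sets P"
      and E': "\<And>wm wp. wm \<in> Bt \<Longrightarrow> wp \<in> path_space H \<Longrightarrow> history T (wm, wp) \<in> E' \<longleftrightarrow> wm \<in> E'" for E'
    proof -
      have "emeasure P (E' \<inter> X) = (\<integral>\<^sup>+ w. indicator (E' \<inter> X) w \<partial>P)"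
        by simp
      also have "\<dots> = (\<integral>\<^sup>+ z. indicator (E' \<inter> X) (history T z) \<partial>(P \<Otimes>\<^sub>M P))"
        using T by (subst nn_integral_history) auto
      also have "\<dots> = (\<integral>\<^sup>+ z. indicator (E' \<times> Y) z \<partial>(P \<Otimes>\<^sub>M P))"
      proof (rule nn_integral_cong_AE)
        show "AE z in P \<Otimes>\<^sub>M P. (indicator (E' \<inter> X) (history T z) :: ennreal) = indicator (E' \<times> Y) z"
          using AE_past[OF AE_Bt] AE_space
        proof eventually_elim
          case (elim z)
          then show ?case
            using iff[of "fst z" "snd z"] E'[of "fst z" "snd z"]
            by (cases z) (auto simp: space_pair_measure space_P indicator_def)
        qed
      qed
      also have "\<dots> = emeasure P E' * emeasure P Y"
        by (simp add: P.emeasure_pair_measure_Times)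
      finally show ?thesis .
    qed
    have "emeasure P (space P \<inter> X) = emeasure P (space P) * emeasure P Y"
      using path_concat_Bt[OF _ _ T(1)] Bt_subset sets.top[of P]
      by (intro *) (auto simp: history_eq space_P)
    moreover have "space P \<inter> X = X"
      using sets.sets_into_space[of X P] by auto
    ultimately have "emeasure P X = emeasure P Y"
      by (simp add: P.emeasure_space_1)
    then show ?thesis
      using *[of E] tail[OF T(1)] by (simp add: history_eq)
  qed
  \<comment> \<open>\<open>P\<close> restricted to \<open>E\<close> and \<open>P\<close> scaled by
    the probability of \<open>E\<close> agree on an intersection-stable generator. Evaluated at
    \<open>E\<close>, this says that the probability is its own square.\<close>
  have "density P (indicator E) = scale_measure (emeasure P E) P"
  proof (rule measure_eqI_generator_eq[OF Int_stable_cylinders])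
    show "cylinders \<subseteq> Pow (path_space H)"
      by (auto simp: cylinders_def)
    fix X assume X: "X \<in> cylinders"
    then show "emeasure (density P (indicator E)) X = emeasure (scale_measure (emeasure P E) P) X"
      using indep[OF X] cylinder_sets[OF X]
      by (simp add: emeasure_density flip: indicator_inter_arith)
  next
    have "path_space H \<in> cylinders"
      unfolding cylinders_def by (intro CollectI exI[of _ "{}"] exI[of _ "\<lambda>_. UNIV"]) auto
    then show "range (\<lambda>_::nat. path_space H) \<subseteq> cylinders" by auto
    show "emeasure (density P (indicator E)) (path_space H) \<noteq> \<infinity>"
      using indep[OF \<open>path_space H \<in> cylinders\<close>] by (simp add: emeasure_density space_P[symmetric] flip: indicator_inter_arith)
  qed (simp_all add: sets_P_cylinders)
  then have "emeasure (density P (indicator E)) E = emeasure (scale_measure (emeasure P E) P) E"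
    by simp
  then have "emeasure P E = emeasure P E * emeasure P E"
    by (simp add: emeasure_density flip: indicator_inter_arith)
  then have "P.prob E = P.prob E * P.prob E"
    by (simp add: P.emeasure_eq_measure flip: ennreal_mult)
  then show ?thesis
    by (auto simp: P.emeasure_eq_measure)
qed

end

section \<open>Pairs of points drawn from the conditional measures\<close>

lemma nn_integral_le_liminf:
  fixes f :: "nat \<Rightarrow> 'a \<Rightarrow> ennreal"
  assumes "\<And>n. f n \<in> borel_measurable M" and "AE x in M. f' x \<le> liminf (\<lambda>n. f n x)"
  shows "(\<integral>\<^sup>+ x. f' x \<partial>M) \<le> liminf (\<lambda>n. \<integral>\<^sup>+ x. f n x \<partial>M)"
  by (rule order_trans[OF nn_integral_mono_AE[OF assms(2)] nn_integral_liminf[OF assms(1)]])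

lemma liminf_le_const:
  fixes f :: "nat \<Rightarrow> ennreal"
  assumes "\<And>n. f n \<le> c" shows "liminf f \<le> c"
  using Liminf_mono[of f "\<lambda>_. c" sequentially] assms by (simp add: Liminf_const)

context stationary_noise_flow
begin

text \<open>The law of two points drawn independently from \<open>K wm\<close>, the second one conditioned to
  differ from the first. The junk value \<open>\<infinity>\<close> of the weight at an atom of full mass is harmless, as
  almost no pair then has distinct points.\<close>

definition pair_weight :: "'n path \<Rightarrow> (real ^ 'n) \<times> (real ^ 'n) \<Rightarrow> ennreal" where
  "pair_weight wm z = (if fst z = snd z then 0 else inverse (1 - emeasure (K wm) {fst z}))"

definition distinct_pairs :: "'n path \<Rightarrow> ((real ^ 'n) \<times> (real ^ 'n)) measure" where
  "distinct_pairs wm = density (K wm \<Otimes>\<^sub>M K wm) (pair_weight wm)"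

text \<open>The singleton moves with \<open>x\<close>, so measurability of the kernel on fixed sets
  does not apply; the indicator of the diagonal is integrated against the kernel instead.\<close>

lemma measurable_atom [measurable]:
  "(\<lambda>(wm, x). emeasure (K wm) {x}) \<in> borel_measurable (P \<Otimes>\<^sub>M borel)"
proof -
  have "(\<lambda>u. \<integral>\<^sup>+ y. (if y = snd u then 1 else 0) \<partial>K (fst u)) \<in> borel_measurable (P \<Otimes>\<^sub>M borel)"
    by (rule nn_integral_measurable_subprob_algebra2[OF _ measurable_compose[OF measurable_fst measurable_kernel]])
       measurable
  moreover have "(\<integral>\<^sup>+ y. (if y = snd u then 1 else 0) \<partial>K (fst u)) = emeasure (K (fst u)) {snd u}"
    if "u \<in> space (P \<Otimes>\<^sub>M borel)" for u
  proof -
    have "(\<integral>\<^sup>+ y. (if y = snd u then 1 else 0) \<partial>K (fst u)) = (\<integral>\<^sup>+ y. indicator {snd u} y \<partial>K (fst u))"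
      by (intro nn_integral_cong) auto
    then show ?thesis
      using that sets_kernel[of "fst u"] by (auto simp: space_pair_measure space_P)
  qed
  ultimately show ?thesis
    by (simp add: case_prod_unfold cong: measurable_cong)
qed

lemma sets_pair_kernel: "wm \<in> path_space H \<Longrightarrow> sets (K wm \<Otimes>\<^sub>M K wm) = sets (borel \<Otimes>\<^sub>M borel)"
  by (intro sets_pair_measure_cong sets_kernel)

lemma sets_distinct_pairs: "wm \<in> path_space H \<Longrightarrow> sets (distinct_pairs wm) = sets (borel \<Otimes>\<^sub>M borel)"
  by (simp add: distinct_pairs_def sets_pair_kernel)

lemma measurable_pair_weight [measurable]:
  "(\<lambda>(wm, z). pair_weight wm z) \<in> borel_measurable (P \<Otimes>\<^sub>M (borel \<Otimes>\<^sub>M borel))"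
proof -
  have "(\<lambda>u. (case (fst u, fst (snd u)) of (wm, x) \<Rightarrow> emeasure (K wm) {x}))
      \<in> borel_measurable (P \<Otimes>\<^sub>M ((borel :: (real ^ 'n) measure) \<Otimes>\<^sub>M (borel :: (real ^ 'n) measure)))"
    by (rule measurable_compose[OF _ measurable_atom]) measurable
  then have [measurable]: "(\<lambda>u. emeasure (K (fst u)) {fst (snd u)})
      \<in> borel_measurable (P \<Otimes>\<^sub>M ((borel :: (real ^ 'n) measure) \<Otimes>\<^sub>M (borel :: (real ^ 'n) measure)))"
    by simp
  show ?thesis
    unfolding pair_weight_def case_prod_unfold by measurable
qed

lemma measurable_pair_weight_fixed:
  assumes "wm \<in> path_space H"
  shows "pair_weight wm \<in> borel_measurable (borel \<Otimes>\<^sub>M borel)"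
  using measurable_compose[OF measurable_Pair1'[of wm P] measurable_pair_weight] assms
  by (simp add: space_P)

lemma measurable_pair_fixed:
  assumes "wm \<in> path_space H" "f \<in> borel_measurable (borel \<Otimes>\<^sub>M borel)"
  shows "f \<in> borel_measurable (K wm \<Otimes>\<^sub>M K wm)"
  using assms(2) measurable_cong_sets[OF sets_pair_kernel[OF assms(1)] refl] by blast

lemma nn_integral_distinct_pairs:
  assumes "wm \<in> path_space H" "f \<in> borel_measurable (borel \<Otimes>\<^sub>M borel)"
  shows "(\<integral>\<^sup>+ z. f z \<partial>distinct_pairs wm) = (\<integral>\<^sup>+ z. pair_weight wm z * f z \<partial>(K wm \<Otimes>\<^sub>M K wm))"
  unfolding distinct_pairs_def
  by (intro nn_integral_density measurable_pair_fixed measurable_pair_weight_fixed assms)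

lemma measurable_nn_integral_distinct_pairs [measurable]:
  assumes [measurable]: "f \<in> borel_measurable (borel \<Otimes>\<^sub>M borel)"
  shows "(\<lambda>wm. \<integral>\<^sup>+ z. f z \<partial>distinct_pairs wm) \<in> borel_measurable P"
proof -
  have "(\<lambda>wm. \<integral>\<^sup>+ z. pair_weight wm z * f z \<partial>(K wm \<Otimes>\<^sub>M K wm)) \<in> borel_measurable P"
    by (rule nn_integral_measurable_subprob_algebra2[OF _ measurable_pair_measure[OF measurable_kernel measurable_kernel]])
       measurable
  then show ?thesis
    by (rule measurable_cong[THEN iffD2, rotated]) (simp add: nn_integral_distinct_pairs space_P)
qed

lemma AE_distinct_pairs:
  assumes "wm \<in> path_space H"
  shows "AE z in distinct_pairs wm. fst z \<noteq> snd z"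
  unfolding distinct_pairs_def
  by (subst AE_density) (auto intro!: measurable_pair_fixed measurable_pair_weight_fixed assms simp: pair_weight_def)

lemma AE_distinct_pairsI:
  assumes "wm \<in> path_space H" "AE z in K wm \<Otimes>\<^sub>M K wm. Q z"
  shows "AE z in distinct_pairs wm. Q z"
  unfolding distinct_pairs_def using assms(2)
  by (subst AE_density) (auto intro!: measurable_pair_fixed measurable_pair_weight_fixed assms(1))

text \<open>For fixed \<open>x\<close>, the integral of the weight over \<open>y\<close> is the mass
  of \<open>- {x}\<close> times its inverse, which is 1 as \<open>{x}\<close> does not have full
  mass. Thus the first point keeps the law \<open>K wm\<close>, and averaging over \<open>wm\<close>
  produces \<open>\<pi>\<close>.\<close>

lemma nn_integral_distinct_pairs_fst:
  assumes wm: "wm \<in> path_space H" and nondirac: "\<And>x. emeasure (K wm) {x} \<noteq> 1"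
    and g [measurable]: "g \<in> borel_measurable borel"
  shows "(\<integral>\<^sup>+ z. g (fst z) \<partial>distinct_pairs wm) = (\<integral>\<^sup>+ x. g x \<partial>K wm)"
proof -
  interpret K: prob_space "K wm" by (rule prob_kernel[OF wm])
  interpret KK: pair_prob_space "K wm" "K wm" ..
  note [simp] = sets_kernel[OF wm] space_kernel[OF wm]
  have "(\<lambda>z. pair_weight wm z * g (fst z)) \<in> borel_measurable (borel \<Otimes>\<^sub>M borel)"
    using measurable_pair_weight_fixed[OF wm] by measurable
  then have "(\<integral>\<^sup>+ z. g (fst z) \<partial>distinct_pairs wm)
      = (\<integral>\<^sup>+ x. \<integral>\<^sup>+ y. pair_weight wm (x, y) * g x \<partial>K wm \<partial>K wm)"
    by (subst nn_integral_distinct_pairs[OF wm], measurable, subst K.nn_integral_fst[symmetric])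
       (auto intro: measurable_pair_fixed[OF wm])
  also have "\<dots> = (\<integral>\<^sup>+ x. g x \<partial>K wm)"
  proof (rule nn_integral_cong)
    fix x
    have compl: "emeasure (K wm) (- {x}) = 1 - emeasure (K wm) {x}"
      using emeasure_compl[of "{x}" "K wm"] K.emeasure_space_1 by (simp add: Compl_eq_Diff_UNIV)
    have "emeasure (K wm) {x} < 1"
      using nondirac[of x] K.emeasure_le_1[of "{x}"] by (simp add: less_le)
    then have "1 - emeasure (K wm) {x} \<noteq> 0" "1 - emeasure (K wm) {x} \<noteq> \<infinity>"
      by (auto simp: ennreal_minus_eq_top dest: ennreal_minus_eq_0)
    then have "inverse (1 - emeasure (K wm) {x}) * (1 - emeasure (K wm) {x}) = 1"
      using ennreal_divide_self[of "1 - emeasure (K wm) {x}"]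
      by (simp add: divide_ennreal_def mult.commute less_top[symmetric])
    moreover have "(\<integral>\<^sup>+ y. pair_weight wm (x, y) * g x \<partial>K wm)
        = (\<integral>\<^sup>+ y. (g x * inverse (1 - emeasure (K wm) {x})) * indicator (- {x}) y \<partial>K wm)"
      by (intro nn_integral_cong) (auto simp: pair_weight_def indicator_def mult.commute)
    ultimately show "(\<integral>\<^sup>+ y. pair_weight wm (x, y) * g x \<partial>K wm) = g x"
      by (simp add: nn_integral_cmult_indicator compl) (simp add: mult.assoc)
  qed
  finally show ?thesis .
qed

lemma emeasure_distinct_pairs:
  assumes "wm \<in> path_space H" "\<And>x. emeasure (K wm) {x} \<noteq> 1"
  shows "emeasure (distinct_pairs wm) (space (distinct_pairs wm)) = 1"
proof -
  interpret K: prob_space "K wm" by (rule prob_kernel) fact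
  show ?thesis
    using nn_integral_distinct_pairs_fst[OF assms, of "\<lambda>_. 1"] K.emeasure_space_1 by simp
qed

lemma measurable_flow:
  assumes "wm \<in> path_space H" "wp \<in> path_space H" "t \<ge> 0"
  shows "\<Phi> t (wm, wp) \<in> borel_measurable borel"
  using continuous_flow_space[of "(wm, wp)" t] assms by (intro borel_measurable_continuous_onI) auto

lemma measurable_flow_kernel:
  assumes "wm \<in> path_space H" "wp \<in> path_space H" "t \<ge> 0"
  shows "\<Phi> t (wm, wp) \<in> K wm \<rightarrow>\<^sub>M borel"
  using measurable_cong_sets[OF sets_kernel[OF assms(1)] refl] measurable_flow[OF assms] by blast

lemma nn_integral_kernel_pairs_flow:
  assumes wm: "wm \<in> Bt" and wp: "wp \<in> path_space H" and t: "t \<ge> 0"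
    and f: "f \<in> borel_measurable (borel \<Otimes>\<^sub>M borel)"
  shows "(\<integral>\<^sup>+ z. f z \<partial>(K (path_concat t (wm, wp)) \<Otimes>\<^sub>M K (path_concat t (wm, wp))))
    = (\<integral>\<^sup>+ (x, y). f (\<Phi> t (wm, wp) x, \<Phi> t (wm, wp) y) \<partial>(K wm \<Otimes>\<^sub>M K wm))"
proof -
  let ?w = "path_concat t (wm, wp)"
  have wm': "wm \<in> path_space H" and w: "?w \<in> path_space H"
    using wm path_concat_Bt[OF wm wp t] Bt_subset by auto
  interpret K: prob_space "K ?w" by (rule prob_kernel[OF w])
  note \<Phi> [measurable] = measurable_flow_kernel[OF wm' wp t]
  have push: "distr (K wm) borel (\<Phi> t (wm, wp)) = K ?w"
    by (rule distr_kernel_flow[OF wm wp t])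
  have "K ?w \<Otimes>\<^sub>M K ?w
      = distr (K wm \<Otimes>\<^sub>M K wm) (borel \<Otimes>\<^sub>M borel) (\<lambda>(x, y). (\<Phi> t (wm, wp) x, \<Phi> t (wm, wp) y))"
    unfolding push[symmetric]
    by (intro pair_measure_distr \<Phi>) (simp add: push K.sigma_finite_measure_axioms)
  then show ?thesis
    using f by (simp add: nn_integral_distr case_prod_unfold)
qed

text \<open>By injectivity the preimage of \<open>{\<Phi> x}\<close> is \<open>{x}\<close>, so atoms
  keep their mass and distinct points stay distinct. The weight is therefore constant along the
  flow, and only the product measure has to be pushed forward.\<close>

lemma nn_integral_distinct_pairs_flow:
  assumes wm: "wm \<in> Bt" and wp: "wp \<in> path_space H" and t: "t \<ge> 0"
    and [measurable]: "f \<in> borel_measurable (borel \<Otimes>\<^sub>M borel)"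
  shows "(\<integral>\<^sup>+ z. f z \<partial>distinct_pairs (path_concat t (wm, wp)))
    = (\<integral>\<^sup>+ (x, y). f (\<Phi> t (wm, wp) x, \<Phi> t (wm, wp) y) \<partial>distinct_pairs wm)"
proof -
  let ?w = "path_concat t (wm, wp)" and ?\<Phi> = "\<Phi> t (wm, wp)"
  have wm': "wm \<in> path_space H" and w: "?w \<in> path_space H"
    using wm path_concat_Bt[OF wm wp t] Bt_subset by auto
  have \<Phi>_borel [measurable]: "?\<Phi> \<in> borel_measurable borel"
    by (rule measurable_flow[OF wm' wp t])
  have push: "distr (K wm) borel ?\<Phi> = K ?w"
    by (rule distr_kernel_flow[OF wm wp t])
  have inj: "inj ?\<Phi>"
    using inj_flow[of "(wm, wp)" t] wm' wp t by simp
  have "emeasure (K ?w) {?\<Phi> x} = emeasure (K wm) {x}" for x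
  proof -
    have "emeasure (K ?w) {?\<Phi> x} = emeasure (K wm) (?\<Phi> -` {?\<Phi> x} \<inter> space (K wm))"
      unfolding push[symmetric] by (rule emeasure_distr[OF measurable_flow_kernel[OF wm' wp t]]) simp
    also have "?\<Phi> -` {?\<Phi> x} \<inter> space (K wm) = {x}"
      using inj by (auto simp: space_kernel[OF wm'] inj_eq)
    finally show ?thesis .
  qed
  then have weight: "pair_weight ?w (?\<Phi> x, ?\<Phi> y) = pair_weight wm (x, y)" for x y
    by (simp add: pair_weight_def inj_eq[OF inj])
  have "(\<integral>\<^sup>+ z. f z \<partial>distinct_pairs ?w)
      = (\<integral>\<^sup>+ (x, y). pair_weight ?w (?\<Phi> x, ?\<Phi> y) * f (?\<Phi> x, ?\<Phi> y) \<partial>(K wm \<Otimes>\<^sub>M K wm))"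
    using measurable_pair_weight_fixed[OF w]
    by (simp add: nn_integral_distinct_pairs[OF w] nn_integral_kernel_pairs_flow[OF wm wp t])
  also have "\<dots> = (\<integral>\<^sup>+ (x, y). pair_weight wm (x, y) * f (?\<Phi> x, ?\<Phi> y) \<partial>(K wm \<Otimes>\<^sub>M K wm))"
    by (simp only: weight)
  also have "\<dots> = (\<integral>\<^sup>+ (x, y). f (?\<Phi> x, ?\<Phi> y) \<partial>distinct_pairs wm)"
    by (subst nn_integral_distinct_pairs[OF wm']) (auto simp: case_prod_unfold)
  finally show ?thesis .
qed

end

section \<open>Dissipation of the logarithmic distance\<close>

text \<open>If \<open>R + C < norm x\<close>, then \<open>norm y \<ge> R\<close> as well, and the
  upper bound \<open>C3\<close> on the expansion rate may be replaced by \<open>- C4\<close>; the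
  gain is \<open>C3 + C4\<close>. Elsewhere the one-sided Lipschitz bound suffices. The factor 2
  comes from differentiating a square.\<close>

lemma (in additive_noise_flow) dissipation:
  fixes x y :: "real ^ 'n"
  assumes mono: "\<And>x y. norm x \<ge> R \<Longrightarrow> norm y \<ge> R \<Longrightarrow> (F x - F y) \<bullet> (x - y) \<le> - C4 * (norm (x - y))\<^sup>2"
    and "norm (x - y) \<le> C" "\<epsilon> > 0" "C4 > 0" "C > 0"
  shows "2 * (C3 + C4) * ((norm (x - y))\<^sup>2 / (\<epsilon> + (norm (x - y))\<^sup>2)) * indicator {x. R + C < norm x} x
    \<le> 2 * C3 - 2 * ((F x - F y) \<bullet> (x - y)) / (\<epsilon> + (norm (x - y))\<^sup>2)"
proof -
  define d where "d = (norm (x - y))\<^sup>2"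
  have pos: "\<epsilon> + d > 0" and "d \<ge> 0"
    using assms by (auto simp: d_def add_pos_nonneg)
  show ?thesis
  proof (cases "R + C < norm x")
    case True
    have "norm y \<ge> R"
      using True assms(2) norm_triangle_ineq2[of x y] by linarith
    then have "(F x - F y) \<bullet> (x - y) \<le> - C4 * d"
      using True assms(5) unfolding d_def by (intro mono) auto
    then have "2 * (C3 + C4) * d \<le> 2 * C3 * (\<epsilon> + d) - 2 * ((F x - F y) \<bullet> (x - y))"
      using C3_pos assms(3) mult_pos_pos[of C3 \<epsilon>]
      unfolding distrib_left distrib_right mult.assoc by linarith
    then have "(2 * (C3 + C4) * d + 2 * ((F x - F y) \<bullet> (x - y))) / (\<epsilon> + d) \<le> 2 * C3"
      using pos by (simp add: pos_divide_le_eq)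
    then show ?thesis
      using True unfolding d_def[symmetric] by (simp add: add_divide_distrib)
  next
    case False
    have "(F x - F y) \<bullet> (x - y) \<le> C3 * (\<epsilon> + d)"
      using one_sided_Lipschitz[of x y] C3_pos assms(3) mult_pos_pos[of C3 \<epsilon>]
      unfolding d_def[symmetric] distrib_left by linarith
    then show ?thesis
      using False pos unfolding d_def[symmetric] by (simp add: field_simps)
  qed
qed

context stationary_noise_flow
begin

text \<open>Stationarity keeps the mean of \<open>L\<close> constant, so \<open>2 * C3\<close> minus
  its difference quotient has mean at most \<open>2 * C3\<close>. Fatou's lemma passes this to the
  derivative, and \<open>dissipation\<close> bounds the limit from below.\<close>

lemma log_distance_dissipation:
  assumes mono: "\<And>x y. norm x \<ge> R \<Longrightarrow> norm y \<ge> R \<Longrightarrow> (F x - F y) \<bullet> (x - y) \<le> - C4 * (norm (x - y))\<^sup>2"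
    and pos: "\<epsilon> > 0" "C4 > 0" "C > 0"
    and nondirac: "AE wm in P. \<forall>x. emeasure (K wm) {x} \<noteq> 1"
    and close: "AE wm in P. AE z in K wm \<Otimes>\<^sub>M K wm. norm (fst z - snd z) \<le> C"
  shows "(\<integral>\<^sup>+ wm. \<integral>\<^sup>+ z. ennreal (2 * (C3 + C4) *
      ((norm (fst z - snd z))\<^sup>2 / (\<epsilon> + (norm (fst z - snd z))\<^sup>2)) * indicator {x. R + C < norm x} (fst z))
      \<partial>distinct_pairs wm \<partial>P) \<le> ennreal (2 * C3)"
proof -
  define L where "L z = ln (1 + (norm (fst z - snd z))\<^sup>2 / \<epsilon>)" for z :: "(real ^ 'n) \<times> (real ^ 'n)"
  define l where "l wm = (\<integral>\<^sup>+ z. ennreal (L z) \<partial>distinct_pairs wm)" for wm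
  define B where "B z = ennreal (2 * (C3 + C4) *
    ((norm (fst z - snd z))\<^sup>2 / (\<epsilon> + (norm (fst z - snd z))\<^sup>2)) * indicator {x. R + C < norm x} (fst z))"
    for z :: "(real ^ 'n) \<times> (real ^ 'n)"
  define good where "good wm \<longleftrightarrow> wm \<in> Bt \<and> (\<forall>x. emeasure (K wm) {x} \<noteq> 1) \<and>
    (AE z in K wm \<Otimes>\<^sub>M K wm. norm (fst z - snd z) \<le> C)" for wm
  have AE_good: "AE wm in P. good wm"
    using AE_Bt nondirac close by eventually_elim (simp add: good_def)
  have L_nonneg: "L z \<ge> 0" for z
    using pos by (simp add: L_def)
  have L_measurable [measurable]: "L \<in> borel_measurable (borel \<Otimes>\<^sub>M borel)"
    unfolding L_def by measurable
  have l_measurable [measurable]: "l \<in> borel_measurable P"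
    unfolding l_def by measurable
  have mass: "emeasure (distinct_pairs wm) (space (distinct_pairs wm)) = 1" if "good wm" for wm
    using that Bt_subset by (intro emeasure_distinct_pairs) (auto simp: good_def)
  \<comment> \<open>The bound \<open>C\<close> on the distance makes the mean of \<open>L\<close>
    finite, without which the two equal means could not be cancelled.\<close>
  have l_bound: "l wm \<le> ennreal (ln (1 + C\<^sup>2 / \<epsilon>))" if "good wm" for wm
  proof -
    have "wm \<in> path_space H" and ae: "AE z in K wm \<Otimes>\<^sub>M K wm. norm (fst z - snd z) \<le> C"
      using that Bt_subset by (auto simp: good_def)
    then have "AE z in distinct_pairs wm. norm (fst z - snd z) \<le> C"
      by (intro AE_distinct_pairsI)
    then have "AE z in distinct_pairs wm. ennreal (L z) \<le> ennreal (ln (1 + C\<^sup>2 / \<epsilon>))"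
    proof eventually_elim
      case (elim z)
      have "(norm (fst z - snd z))\<^sup>2 / \<epsilon> \<le> C\<^sup>2 / \<epsilon>"
        using elim pos by (intro divide_right_mono power_mono) auto
      moreover have "0 \<le> (norm (fst z - snd z))\<^sup>2 / \<epsilon>"
        using pos by simp
      ultimately show ?case
        unfolding L_def by (intro ennreal_leI ln_mono) auto
    qed
    then have "l wm \<le> (\<integral>\<^sup>+ z. ennreal (ln (1 + C\<^sup>2 / \<epsilon>)) \<partial>distinct_pairs wm)"
      unfolding l_def by (rule nn_integral_mono_AE)
    then show ?thesis
      using mass[OF that] by simp
  qed
  have El: "(\<integral>\<^sup>+ wm. l wm \<partial>P) \<noteq> \<infinity>"
  proof -
    have "(\<integral>\<^sup>+ wm. l wm \<partial>P) \<le> (\<integral>\<^sup>+ wm. ennreal (ln (1 + C\<^sup>2 / \<epsilon>)) \<partial>P)"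
      using AE_good by (intro nn_integral_mono_AE) (auto elim!: eventually_mono intro: l_bound)
    then show ?thesis
      by (auto simp: P.emeasure_space_1 top_unique)
  qed
  \<comment> \<open>The quotients below carry the factor \<open>Suc n\<close>, the inverse of this
    step, which turns the increment bound \<open>2 * C3 * \<tau> n\<close> into
    \<open>2 * C3\<close> for every \<open>n\<close>.\<close>
  define \<tau> where "\<tau> n = 1 / real (Suc n)" for n
  have \<tau>: "\<tau> n \<ge> 0" for n
    by (simp add: \<tau>_def)
  note [measurable] = measurable_history[OF \<tau>]
  \<comment> \<open>\<open>2 * C3\<close> minus the growth rate of \<open>l\<close> over one step.
    Subtraction in \<open>ennreal\<close> truncates, so \<open>A_balance\<close> states the identity
    additively and \<open>A_eq\<close> returns to the difference where \<open>l\<close> is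
    finite.\<close>
  define A where "A n z = ennreal (2 * C3) + of_nat (Suc n) * l (fst z) - of_nat (Suc n) * l (history (\<tau> n) z)" for n z
  have A_measurable [measurable]: "A n \<in> borel_measurable (P \<Otimes>\<^sub>M P)" for n
    unfolding A_def by measurable

  text \<open>For a fixed noise path \<open>z\<close>, \<open>A n z\<close> is the integral of the nonnegative function \<open>u n z\<close>.\<close>
  define u where "u n z v = 2 * C3 - real (Suc n) *
    (L (\<Phi> (\<tau> n) z (fst v), \<Phi> (\<tau> n) z (snd v)) - L v)" for n z v
  have A_balance: "(\<integral>\<^sup>+ v. ennreal (u n z v) \<partial>distinct_pairs (fst z)) + of_nat (Suc n) * l (history (\<tau> n) z)
      = ennreal (2 * C3) + of_nat (Suc n) * l (fst z)"
    and u_nonneg: "u n z v \<ge> 0" and u_measurable: "u n z \<in> borel_measurable (borel \<Otimes>\<^sub>M borel)"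
    if z: "good (fst z)" "snd z \<in> path_space H" for n z v
  proof -
    obtain wm wp where z_eq: "z = (wm, wp)" by (cases z)
    have wm: "wm \<in> Bt" "wm \<in> path_space H" and wp: "wp \<in> path_space H"
      using z Bt_subset by (auto simp: good_def z_eq)
    have [measurable]: "\<Phi> (\<tau> n) z \<in> borel_measurable borel"
      unfolding z_eq by (rule measurable_flow[OF wm(2) wp \<tau>])
    show um: "u n z \<in> borel_measurable (borel \<Otimes>\<^sub>M borel)"
      unfolding u_def by measurable
    have nonneg: "u n z v \<ge> 0" for v
    proof -
      have "L (\<Phi> (\<tau> n) z (fst v), \<Phi> (\<tau> n) z (snd v)) - L v \<le> 2 * C3 * \<tau> n"
        using log_distance_increment_le[of z "\<tau> n" \<epsilon> "fst v" "snd v"] pos(1) \<tau> wm wp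
        by (simp add: L_def z_eq)
      then have "real (Suc n) * (L (\<Phi> (\<tau> n) z (fst v), \<Phi> (\<tau> n) z (snd v)) - L v) \<le> real (Suc n) * (2 * C3 * \<tau> n)"
        by (rule mult_left_mono) simp
      then show ?thesis
        by (simp add: u_def \<tau>_def)
    qed
    then show "u n z v \<ge> 0" .
    note sets_J = sets_distinct_pairs[OF wm(2)]
    have J [measurable]: "f \<in> borel_measurable (distinct_pairs wm)"
      if "f \<in> borel_measurable (borel \<Otimes>\<^sub>M borel)" for f :: "_ \<Rightarrow> ennreal"
      using that measurable_cong_sets[OF sets_J refl] by blast
    have "l (history (\<tau> n) z) = (\<integral>\<^sup>+ v. ennreal (L (\<Phi> (\<tau> n) z (fst v), \<Phi> (\<tau> n) z (snd v))) \<partial>distinct_pairs wm)"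
      unfolding l_def z_eq history_eq[OF wm(1)]
      by (subst nn_integral_distinct_pairs_flow[OF wm(1) wp \<tau>]) (simp_all add: case_prod_unfold)
    then have "(\<integral>\<^sup>+ v. ennreal (u n z v) \<partial>distinct_pairs wm) + of_nat (Suc n) * l (history (\<tau> n) z)
        = (\<integral>\<^sup>+ v. ennreal (u n z v) + of_nat (Suc n) *
            ennreal (L (\<Phi> (\<tau> n) z (fst v), \<Phi> (\<tau> n) z (snd v))) \<partial>distinct_pairs wm)"
      using um by (simp add: nn_integral_add nn_integral_cmult J)
    also have "\<dots> = (\<integral>\<^sup>+ v. ennreal (2 * C3) + of_nat (Suc n) * ennreal (L v) \<partial>distinct_pairs wm)"
    proof (rule nn_integral_cong)
      fix v
      have "u n z v + real (Suc n) * L (\<Phi> (\<tau> n) z (fst v), \<Phi> (\<tau> n) z (snd v)) = 2 * C3 + real (Suc n) * L v"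
        by (simp add: u_def algebra_simps)
      then show "ennreal (u n z v) + of_nat (Suc n) * ennreal (L (\<Phi> (\<tau> n) z (fst v), \<Phi> (\<tau> n) z (snd v)))
          = ennreal (2 * C3) + of_nat (Suc n) * ennreal (L v)"
        using nonneg[of v] L_nonneg C3_pos
        by (simp only: ennreal_of_nat_eq_real_of_nat ennreal_mult[symmetric] ennreal_plus[symmetric]
            of_nat_0_le_iff mult_nonneg_nonneg)
    qed
    also have "\<dots> = ennreal (2 * C3) + of_nat (Suc n) * l wm"
      using mass[of wm] z(1) unfolding l_def
      by (simp add: nn_integral_add nn_integral_cmult J z_eq)
    finally show "(\<integral>\<^sup>+ v. ennreal (u n z v) \<partial>distinct_pairs (fst z)) + of_nat (Suc n) * l (history (\<tau> n) z)
      = ennreal (2 * C3) + of_nat (Suc n) * l (fst z)"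
      by (simp add: z_eq)
  qed
  \<comment> \<open>Stationarity transfers almost sure properties of the past to the new history,
    for all \<open>n\<close> at once as there are countably many.\<close>
  have AE_good2: "AE z in P \<Otimes>\<^sub>M P. good (fst z) \<and> snd z \<in> path_space H \<and> (\<forall>n. good (history (\<tau> n) z))"
  proof -
    have "AE z in P \<Otimes>\<^sub>M P. \<forall>n. good (history (\<tau> n) z)"
      unfolding AE_all_countable by (intro allI AE_history \<tau> AE_good)
    with AE_past[OF AE_good] AE_space show ?thesis
      by eventually_elim (auto simp: space_pair_measure space_P)
  qed
  have A_eq: "(\<integral>\<^sup>+ v. ennreal (u n z v) \<partial>distinct_pairs (fst z)) = A n z"
    if "good (fst z)" "snd z \<in> path_space H" "good (history (\<tau> n) z)" for n z
  proof -
    have "of_nat (Suc n) * l (history (\<tau> n) z) \<noteq> \<top>"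
      using l_bound[OF that(3)] by (auto simp: ennreal_mult_eq_top_iff top_unique)
    then show ?thesis
      unfolding A_def A_balance[OF that(1,2), symmetric] by simp
  qed
  \<comment> \<open>By stationarity \<open>l (fst z)\<close> and
    \<open>l (history (\<tau> n) z)\<close> have the same finite integral, which cancels.\<close>
  have "(\<integral>\<^sup>+ z. A n z \<partial>(P \<Otimes>\<^sub>M P)) \<le> ennreal (2 * C3)" for n
  proof -
    have fin: "of_nat (Suc n) * (\<integral>\<^sup>+ wm. l wm \<partial>P) \<noteq> \<top>"
      using El by (auto simp: ennreal_mult_eq_top_iff)
    have "(\<integral>\<^sup>+ z. A n z \<partial>(P \<Otimes>\<^sub>M P)) + of_nat (Suc n) * (\<integral>\<^sup>+ wm. l wm \<partial>P)
        = (\<integral>\<^sup>+ z. A n z + of_nat (Suc n) * l (history (\<tau> n) z) \<partial>(P \<Otimes>\<^sub>M P))"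
      by (subst nn_integral_add) (auto simp: nn_integral_cmult nn_integral_history[OF \<tau>])
    also have "\<dots> = (\<integral>\<^sup>+ z. ennreal (2 * C3) + of_nat (Suc n) * l (fst z) \<partial>(P \<Otimes>\<^sub>M P))"
    proof (rule nn_integral_cong_AE)
      show "AE z in P \<Otimes>\<^sub>M P. A n z + of_nat (Suc n) * l (history (\<tau> n) z)
          = ennreal (2 * C3) + of_nat (Suc n) * l (fst z)"
        using AE_good2
      proof eventually_elim
        case (elim z)
        then show ?case
          using A_balance[of z n] A_eq[of z n] by simp
      qed
    qed
    also have "\<dots> = ennreal (2 * C3) + of_nat (Suc n) * (\<integral>\<^sup>+ wm. l wm \<partial>P)"
      by (subst nn_integral_add) (auto simp: nn_integral_cmult nn_integral_past PP.emeasure_space_1)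
    finally show ?thesis
      using fin by (simp add: ennreal_add_left_cancel add.commute)
  qed
  then have "liminf (\<lambda>n. \<integral>\<^sup>+ z. A n z \<partial>(P \<Otimes>\<^sub>M P)) \<le> ennreal (2 * C3)"
    by (rule liminf_le_const)
  \<comment> \<open>Fatou's lemma is applied twice: over the noise and, for fixed noise, over the
    pairs of points.\<close>
  moreover have "(\<integral>\<^sup>+ z. \<integral>\<^sup>+ v. B v \<partial>distinct_pairs (fst z) \<partial>(P \<Otimes>\<^sub>M P)) \<le> liminf (\<lambda>n. \<integral>\<^sup>+ z. A n z \<partial>(P \<Otimes>\<^sub>M P))"
  proof (rule nn_integral_le_liminf[OF A_measurable])
    show "AE z in P \<Otimes>\<^sub>M P. (\<integral>\<^sup>+ v. B v \<partial>distinct_pairs (fst z)) \<le> liminf (\<lambda>n. A n z)"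
      using AE_good2
    proof eventually_elim
      case (elim z)
      then have z: "good (fst z)" "snd z \<in> path_space H" by auto
      then have wm: "fst z \<in> path_space H" and ae: "AE v in K (fst z) \<Otimes>\<^sub>M K (fst z). norm (fst v - snd v) \<le> C"
        using Bt_subset by (auto simp: good_def)
      have "(\<integral>\<^sup>+ v. B v \<partial>distinct_pairs (fst z))
          \<le> liminf (\<lambda>n. \<integral>\<^sup>+ v. ennreal (u n z v) \<partial>distinct_pairs (fst z))"
      proof (rule nn_integral_le_liminf)
        show "(\<lambda>v. ennreal (u n z v)) \<in> borel_measurable (distinct_pairs (fst z))" for n
          using measurable_compose[OF u_measurable[OF z, of n] measurable_ennreal]
            measurable_cong_sets[OF sets_distinct_pairs[OF wm] refl] by blast
        show "AE v in distinct_pairs (fst z). B v \<le> liminf (\<lambda>n. ennreal (u n z v))"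
          using AE_distinct_pairsI[OF wm ae]
        proof eventually_elim
          case (elim v)
          let ?d = "2 * ((F (fst v) - F (snd v)) \<bullet> (fst v - snd v)) / (\<epsilon> + (norm (fst v - snd v))\<^sup>2)"
          have "(\<lambda>n. u n z v) \<longlonglongrightarrow> 2 * C3 - ?d"
            unfolding u_def L_def \<tau>_def fst_conv snd_conv
            using log_distance_difference_quotient[of z \<epsilon> "fst v" "snd v"] wm z(2) pos(1)
            by (intro tendsto_diff tendsto_const) (auto simp: mem_Times_iff)
          then have "(\<lambda>n. ennreal (u n z v)) \<longlonglongrightarrow> ennreal (2 * C3 - ?d)"
            by (rule tendsto_ennrealI)
          then have "liminf (\<lambda>n. ennreal (u n z v)) = ennreal (2 * C3 - ?d)"
            by (intro lim_imp_Liminf) auto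
          then show ?case
            unfolding B_def
            by (simp only:) (intro ennreal_leI dissipation mono elim pos)
        qed
      qed
      then show ?case
        using A_eq elim by simp
    qed
  qed
  moreover have "(\<integral>\<^sup>+ z. \<integral>\<^sup>+ v. B v \<partial>distinct_pairs (fst z) \<partial>(P \<Otimes>\<^sub>M P)) = (\<integral>\<^sup>+ wm. \<integral>\<^sup>+ v. B v \<partial>distinct_pairs wm \<partial>P)"
    by (rule nn_integral_past, rule measurable_nn_integral_distinct_pairs, unfold B_def) measurable
  ultimately show ?thesis
    unfolding B_def by simp
qed

text \<open>Take \<open>\<epsilon> = 1 / (k + 1)\<close>. Off the diagonal, which is null for
  \<open>distinct_pairs wm\<close>, the ratio \<open>d / (\<epsilon> + d)\<close> tends to 1. The
  limit depends on the first point only, whose law is \<open>K wm\<close>.\<close>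

lemma kernel_mass_outside:
  assumes mono: "\<And>x y. norm x \<ge> R \<Longrightarrow> norm y \<ge> R \<Longrightarrow> (F x - F y) \<bullet> (x - y) \<le> - C4 * (norm (x - y))\<^sup>2"
    and pos: "C4 > 0" "C > 0"
    and nondirac: "AE wm in P. \<forall>x. emeasure (K wm) {x} \<noteq> 1"
    and close: "AE wm in P. AE z in K wm \<Otimes>\<^sub>M K wm. norm (fst z - snd z) \<le> C"
  shows "ennreal (C3 + C4) * (\<integral>\<^sup>+ wm. emeasure (K wm) {x. R + C < norm x} \<partial>P) \<le> ennreal C3"
proof -
  define B where "B k z = ennreal (2 * (C3 + C4) *
    ((norm (fst z - snd z))\<^sup>2 / (1 / real (Suc k) + (norm (fst z - snd z))\<^sup>2)) * indicator {x. R + C < norm x} (fst z))"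
    for k and z :: "(real ^ 'n) \<times> (real ^ 'n)"
  have B_measurable [measurable]: "B k \<in> borel_measurable (borel \<Otimes>\<^sub>M borel)" for k
    unfolding B_def by measurable
  have "(\<integral>\<^sup>+ wm. \<integral>\<^sup>+ z. B k z \<partial>distinct_pairs wm \<partial>P) \<le> ennreal (2 * C3)" for k
    unfolding B_def by (intro log_distance_dissipation assms) auto
  then have "liminf (\<lambda>k. \<integral>\<^sup>+ wm. \<integral>\<^sup>+ z. B k z \<partial>distinct_pairs wm \<partial>P) \<le> ennreal (2 * C3)"
    by (rule liminf_le_const)
  moreover have "(\<integral>\<^sup>+ wm. ennreal (2 * (C3 + C4)) * emeasure (K wm) {x. R + C < norm x} \<partial>P)
      \<le> liminf (\<lambda>k. \<integral>\<^sup>+ wm. \<integral>\<^sup>+ z. B k z \<partial>distinct_pairs wm \<partial>P)"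
  proof (rule nn_integral_le_liminf)
    show "AE wm in P. ennreal (2 * (C3 + C4)) * emeasure (K wm) {x. R + C < norm x}
        \<le> liminf (\<lambda>k. \<integral>\<^sup>+ z. B k z \<partial>distinct_pairs wm)"
      using nondirac AE_space
    proof eventually_elim
      case (elim wm)
      then have wm: "wm \<in> path_space H" by (simp add: space_P)
      have "ennreal (2 * (C3 + C4)) * emeasure (K wm) {x. R + C < norm x}
          = (\<integral>\<^sup>+ x. ennreal (2 * (C3 + C4)) * indicator {x. R + C < norm x} x \<partial>K wm)"
        by (simp add: nn_integral_cmult_indicator sets_kernel[OF wm])
      also have "\<dots> = (\<integral>\<^sup>+ z. ennreal (2 * (C3 + C4)) * indicator {x. R + C < norm x} (fst z) \<partial>distinct_pairs wm)"
        using elim by (intro nn_integral_distinct_pairs_fst[symmetric] wm) auto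
      also have "\<dots> \<le> liminf (\<lambda>k. \<integral>\<^sup>+ z. B k z \<partial>distinct_pairs wm)"
      proof (rule nn_integral_le_liminf)
        show "B k \<in> borel_measurable (distinct_pairs wm)" for k
          using B_measurable measurable_cong_sets[OF sets_distinct_pairs[OF wm] refl] by blast
        show "AE z in distinct_pairs wm. ennreal (2 * (C3 + C4)) * indicator {x. R + C < norm x} (fst z)
            \<le> liminf (\<lambda>k. B k z)"
          using AE_distinct_pairs[OF wm]
        proof eventually_elim
          case (elim z)
          let ?d = "(norm (fst z - snd z))\<^sup>2"
          have "(\<lambda>k. 1 / real (Suc k)) \<longlonglongrightarrow> 0"
            using LIMSEQ_inverse_real_of_nat by (simp add: inverse_eq_divide)
          then have "(\<lambda>k. 2 * (C3 + C4) * (?d / (1 / real (Suc k) + ?d)) * indicator {x. R + C < norm x} (fst z))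
              \<longlonglongrightarrow> 2 * (C3 + C4) * (?d / (0 + ?d)) * indicator {x. R + C < norm x} (fst z)"
            using elim by (intro tendsto_intros) auto
          then have "(\<lambda>k. B k z) \<longlonglongrightarrow> ennreal (2 * (C3 + C4) * (?d / (0 + ?d)) * indicator {x. R + C < norm x} (fst z))"
            unfolding B_def by (rule tendsto_ennrealI)
          then have "liminf (\<lambda>k. B k z) = ennreal (2 * (C3 + C4) * (?d / (0 + ?d)) * indicator {x. R + C < norm x} (fst z))"
            by (intro lim_imp_Liminf) auto
          then show ?case
            using elim by (simp add: indicator_def)
        qed
      qed
      finally show ?case .
    qed
  qed measurable
  moreover have "(\<integral>\<^sup>+ wm. ennreal (2 * (C3 + C4)) * emeasure (K wm) {x. R + C < norm x} \<partial>P)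
      = ennreal 2 * (ennreal (C3 + C4) * (\<integral>\<^sup>+ wm. emeasure (K wm) {x. R + C < norm x} \<partial>P))"
  proof -
    have "ennreal (2 * (C3 + C4)) = ennreal 2 * ennreal (C3 + C4)"
      using C3_pos pos by (intro ennreal_mult) auto
    then show ?thesis
      by (subst nn_integral_cmult) (measurable, simp only: mult.assoc)
  qed
  ultimately have "ennreal 2 * (ennreal (C3 + C4) * (\<integral>\<^sup>+ wm. emeasure (K wm) {x. R + C < norm x} \<partial>P))
      \<le> ennreal 2 * ennreal C3"
    using C3_pos by (simp add: ennreal_mult)
  then show ?thesis
    by (simp add: ennreal_mult_le_mult_iff)
qed

end

section \<open>Point masses\<close>

context stationary_noise_flow
begin

definition dirac_set :: "'n path set" where
  "dirac_set = {wm \<in> space P. \<exists>x. emeasure (K wm) {x} = 1}"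

text \<open>The off-diagonal mass is the integral of \<open>K wm (- {x})\<close> against
  \<open>K wm\<close>, so it vanishes exactly when almost every point is an atom of full mass. This
  replaces a quantifier over uncountably many \<open>x\<close> by an integral measurable in
  \<open>wm\<close>.\<close>

lemma dirac_iff:
  assumes wm: "wm \<in> path_space H"
  shows "(\<exists>x. emeasure (K wm) {x} = 1) \<longleftrightarrow>
    (\<integral>\<^sup>+ z. (if fst z = snd z then 0 else 1) \<partial>(K wm \<Otimes>\<^sub>M K wm)) = 0"
proof -
  interpret K: prob_space "K wm" by (rule prob_kernel[OF wm])
  interpret KK: pair_prob_space "K wm" "K wm" ..
  note [simp] = sets_kernel[OF wm] space_kernel[OF wm]
  have [measurable]: "(\<lambda>z. if fst z = snd z then 0 else 1 :: ennreal) \<in> borel_measurable (K wm \<Otimes>\<^sub>M K wm)"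
    by (intro measurable_pair_fixed[OF wm]) measurable
  have iff: "emeasure (K wm) {x} = 1 \<longleftrightarrow> emeasure (K wm) (- {x}) = 0" for x
    using K.prob_compl[of "{x}"] by (auto simp: K.emeasure_eq_measure Compl_eq_Diff_UNIV)
  have "emeasure (K wm) (- {x}) = 1 - emeasure (K wm) {x}" for x
    using emeasure_compl[of "{x}" "K wm"] K.emeasure_space_1 by (simp add: Compl_eq_Diff_UNIV)
  moreover have "(\<lambda>x. emeasure (K wm) {x}) \<in> borel_measurable borel"
    using measurable_compose[OF measurable_Pair1'[of wm P borel] measurable_atom] wm by (simp add: space_P)
  ultimately have compl_measurable: "(\<lambda>x. emeasure (K wm) (- {x})) \<in> borel_measurable (K wm)"
    by (simp add: measurable_cong_sets[OF sets_kernel[OF wm] refl])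
  have "(\<integral>\<^sup>+ y. (if x = y then 0 else 1) \<partial>K wm) = emeasure (K wm) (- {x})" for x
  proof -
    have "(\<integral>\<^sup>+ y. (if x = y then 0 else 1) \<partial>K wm) = (\<integral>\<^sup>+ y. indicator (- {x}) y \<partial>K wm)"
      by (intro nn_integral_cong) (auto simp: indicator_def)
    then show ?thesis by simp
  qed
  then have eq: "(\<integral>\<^sup>+ z. (if fst z = snd z then 0 else 1) \<partial>(K wm \<Otimes>\<^sub>M K wm))
      = (\<integral>\<^sup>+ x. emeasure (K wm) (- {x}) \<partial>K wm)"
    by (subst K.nn_integral_fst[symmetric]) auto
  show ?thesis
  proof
    assume "\<exists>x. emeasure (K wm) {x} = 1"
    then obtain b where b: "emeasure (K wm) {b} = 1" by blast
    have "AE x in K wm. x = b"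
      using K.AE_prob_1[of "{b}"] b by (simp add: K.emeasure_eq_measure)
    then have "AE x in K wm. emeasure (K wm) (- {x}) = 0"
      by eventually_elim (use b iff in simp)
    then show "(\<integral>\<^sup>+ z. (if fst z = snd z then 0 else 1) \<partial>(K wm \<Otimes>\<^sub>M K wm)) = 0"
      unfolding eq by (subst nn_integral_cong_AE) auto
  next
    assume 0: "(\<integral>\<^sup>+ z. (if fst z = snd z then 0 else 1) \<partial>(K wm \<Otimes>\<^sub>M K wm)) = 0"
    show "\<exists>x. emeasure (K wm) {x} = 1"
    proof (rule ccontr)
      assume "\<not> ?thesis"
      then have "emeasure (K wm) (- {x}) \<noteq> 0" for x
        using iff by blast
      moreover have "AE x in K wm. emeasure (K wm) (- {x}) = 0"
        using 0 compl_measurable unfolding eq by (simp add: nn_integral_0_iff_AE)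
      ultimately show False
        using K.AE_False by simp
    qed
  qed
qed

lemma dirac_set_sets: "dirac_set \<in> sets P"
proof -
  have [measurable]: "(\<lambda>wm. \<integral>\<^sup>+ z. (if fst z = snd z then 0 else 1) \<partial>(K wm \<Otimes>\<^sub>M K wm)) \<in> borel_measurable P"
    by (rule nn_integral_measurable_subprob_algebra2[OF _ measurable_pair_measure[OF measurable_kernel measurable_kernel]])
       measurable
  have "dirac_set = {wm \<in> space P. (\<integral>\<^sup>+ z. (if fst z = snd z then 0 else 1) \<partial>(K wm \<Otimes>\<^sub>M K wm)) = 0}"
    using dirac_iff by (auto simp: dirac_set_def space_P)
  also have "\<dots> \<in> sets P"
    by measurable
  finally show ?thesis .
qed

text \<open>An injective map sends distinct pairs to distinct pairs, so the off-diagonal mass is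
  unchanged by the flow.\<close>

lemma dirac_set_tail:
  assumes "t \<ge> 0" "wm \<in> Bt" "wp \<in> path_space H"
  shows "path_concat t (wm, wp) \<in> dirac_set \<longleftrightarrow> wm \<in> dirac_set"
proof -
  have wm: "wm \<in> path_space H" and w: "path_concat t (wm, wp) \<in> path_space H"
    using path_concat_Bt[OF assms(2,3,1)] assms(2) Bt_subset by auto
  have "(\<integral>\<^sup>+ z. (if fst z = snd z then 0 else 1) \<partial>(K (path_concat t (wm, wp)) \<Otimes>\<^sub>M K (path_concat t (wm, wp))))
      = (\<integral>\<^sup>+ z. (if fst z = snd z then 0 else 1) \<partial>(K wm \<Otimes>\<^sub>M K wm))"
    using inj_flow[of "(wm, wp)" t] wm assms
    by (subst nn_integral_kernel_pairs_flow) (auto simp: case_prod_unfold inj_eq)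
  then show ?thesis
    using dirac_iff[OF wm] dirac_iff[OF w] wm w by (simp add: dirac_set_def space_P)
qed

lemma AE_dirac:
  assumes mono: "\<And>x y. norm x \<ge> R \<Longrightarrow> norm y \<ge> R \<Longrightarrow> (F x - F y) \<bullet> (x - y) \<le> - C4 * (norm (x - y))\<^sup>2"
    and pos: "C4 > 0" "C > 0"
    and close: "AE wm in P. AE z in K wm \<Otimes>\<^sub>M K wm. norm (fst z - snd z) \<le> C"
    and small: "measure (distr \<mu> borel fst) (cball 0 (R + C)) < C4 / (C3 + C4)"
  shows "AE wm in P. \<exists>x. emeasure (K wm) {x} = 1"
proof -
  have "emeasure P dirac_set \<noteq> 0"
  proof
    assume "emeasure P dirac_set = 0"
    then have "AE wm in P. wm \<notin> dirac_set"
      using dirac_set_sets by (intro AE_not_in) (simp add: null_sets_def)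
    with AE_space have nondirac: "AE wm in P. \<forall>x. emeasure (K wm) {x} \<noteq> 1"
      by eventually_elim (auto simp: dirac_set_def)
    let ?O = "{x :: real ^ 'n. R + C < norm x}" and ?\<pi> = "distr \<mu> borel fst"
    interpret \<mu>: prob_space \<mu>
      using invariant by (simp add: invariant_measure_def)
    have sets_\<mu>: "sets \<mu> = sets (borel \<Otimes>\<^sub>M P)"
      using invariant sets_pair_measure_cong[OF refl[of "sets (borel :: (real ^ 'n) measure)"] sets_P]
      by (simp add: invariant_measure_def)
    have fst [measurable]: "fst \<in> \<mu> \<rightarrow>\<^sub>M borel"
      using measurable_fst[of borel P] measurable_cong_sets[OF sets_\<mu> refl] by blast
    interpret \<pi>: prob_space ?\<pi>
      by (rule \<mu>.prob_space_distr) (rule fst)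
    have "emeasure ?\<pi> ?O = emeasure \<mu> (?O \<times> space P)"
      using sets_eq_imp_space_eq[OF sets_\<mu>]
      by (subst emeasure_distr) (auto simp: space_pair_measure intro!: arg_cong[of _ _ "emeasure \<mu>"])
    also have "\<dots> = (\<integral>\<^sup>+ wm\<in>space P. emeasure (K wm) ?O \<partial>P)"
      using disintegration sets.top[of P] unfolding flow_disintegration_def by simp
    also have "\<dots> = (\<integral>\<^sup>+ wm. emeasure (K wm) ?O \<partial>P)"
      by (intro nn_integral_cong) auto
    finally have "ennreal (C3 + C4) * emeasure ?\<pi> ?O \<le> ennreal C3"
      using kernel_mass_outside[OF mono pos nondirac close] by simp
    then have "ennreal ((C3 + C4) * measure ?\<pi> ?O) \<le> ennreal C3"
      using C3_pos pos by (simp add: \<pi>.emeasure_eq_measure ennreal_mult del: ennreal_plus)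
    then have "(C3 + C4) * measure ?\<pi> ?O \<le> C3"
      using C3_pos by (simp add: ennreal_le_iff)
    moreover have "measure ?\<pi> ?O = 1 - measure ?\<pi> (cball 0 (R + C))"
      using \<pi>.prob_compl[of "cball 0 (R + C)"]
      by (simp add: set_diff_eq not_le)
    \<comment> \<open>Here the threshold arises: with \<open>p\<close> the mass of the ball,
      \<open>(C3 + C4) * (1 - p) \<le> C3\<close> means
      \<open>p \<ge> C4 / (C3 + C4)\<close>.\<close>
    ultimately have "C4 \<le> (C3 + C4) * measure ?\<pi> (cball 0 (R + C))"
      by (simp only: right_diff_distrib) simp
    then show False
      using small C3_pos pos by (simp add: field_simps)
  qed
  then have "emeasure P dirac_set = 1"
    using zero_one_law[OF dirac_set_sets dirac_set_tail] by blast
  then have "AE wm in P. wm \<in> dirac_set"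
    using P.AE_prob_1[of dirac_set] by (simp add: P.emeasure_eq_measure)
  then show ?thesis
    by eventually_elim (simp add: dirac_set_def)
qed

end

text \<open>The complement of \<open>{b}\<close> is open and null, and every open set around
  \<open>b\<close> has full mass.\<close>

lemma measure_support_dirac:
  fixes b :: "'a::t1_space"
  assumes "prob_space M" and sets: "sets M = sets borel" and b: "emeasure M {b} = 1"
  shows "measure_support M = {b}"
proof -
  interpret prob_space M by fact
  have meas: "U \<in> sets M" if "open U" for U
    using that by (simp add: sets)
  have "emeasure M U > 0" if "open U" "b \<in> U" for U
  proof -
    have "1 \<le> emeasure M U"
      using emeasure_mono[of "{b}" U M] meas that b by simp
    then show ?thesis
      by (rule less_le_trans[OF zero_less_one])
  qed
  then have "b \<in> measure_support M"
    by (simp add: measure_support_def)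
  moreover have "x \<notin> measure_support M" if "x \<noteq> b" for x
  proof -
    have "emeasure M (- {b}) = 0"
      using prob_compl[of "{b}"] b sets_eq_imp_space_eq[OF sets]
      by (simp add: emeasure_eq_measure Compl_eq_Diff_UNIV sets)
    then show ?thesis
      using that by (auto simp: measure_support_def intro!: exI[of _ "- {b}"])
  qed
  ultimately show ?thesis
    by auto
qed

theorem corollary5p3:
  fixes H C3 C4 R C r CF' p1 \<alpha> :: real
    and F :: "real ^ 'n::finite \<Rightarrow> real ^ 'n"
    and \<sigma> :: "real ^ 'n ^ 'n"
    and P :: "'n path measure"
    and D :: "'n path \<Rightarrow> 'n path"
    and \<Phi> :: "real \<Rightarrow> 'n path \<times> 'n path \<Rightarrow> real ^ 'n \<Rightarrow> real ^ 'n"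
    and \<mu> :: "((real ^ 'n) \<times> 'n path) measure"
    and Bt :: "'n path set"
    and K :: "'n path \<Rightarrow> (real ^ 'n) measure"
    and lam1 :: ereal
  assumes "0 < H" "H < 1"
    and "wiener_measure H P"
    and "fractional_operator H P \<alpha> D"
    and "invertible \<sigma>"
    and "drift_conditions H F C3"
    and "sde_flow H D F \<sigma> \<Phi>"
    and "unique_invariant_measure H P \<Phi> \<mu>"
    and "flow_disintegration H P \<Phi> \<mu> Bt K"
    and "R > 0" "C4 > 0"
    and "\<And>x y. norm x \<ge> R \<Longrightarrow> norm y \<ge> R \<Longrightarrow>
           (F x - F y) \<bullet> (x - y) \<le> - C4 * (norm (x - y))\<^sup>2"
    and "top_lyapunov_exponent P \<Phi> \<mu> lam1"
    and "lam1 < 0"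
    and "0 < r" "r \<le> 1" "CF' > 0" "p1 \<ge> 1"
    and "\<And>y z. onorm (\<lambda>v. frechet_derivative F (at y) v - frechet_derivative F (at z) v)
           \<le> CF' * (1 + norm y + norm z) powr p1 * norm (y - z) powr r"
    and "C > 0"
    and "(\<integral>\<^sup>+ wm\<in>Bt. emeasure (K wm \<Otimes>\<^sub>M K wm) {(x, y). norm (x - y) > C} \<partial>P) = 0"
    and "measure (distr \<mu> borel fst) (cball 0 (R + C)) < C4 / (C3 + C4)"
  shows "\<exists>b. b \<in> borel_measurable (restrict_space P Bt) \<and>
           (AE wm in P. wm \<in> Bt \<longrightarrow> measure_support (K wm) = {b wm})"
proof -
  \<comment> \<open>This is \<open>noise_0\<close>: a continuous map sends points of
    \<open>path_space H\<close> into \<open>path_space (1 - H)\<close>, whose elements vanish at 0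
    by definition.\<close>
  have "D w 0 = 0" if "w \<in> path_space H" for w
  proof -
    have "D \<in> topspace (path_topology H) \<rightarrow> topspace (path_topology (1 - H))"
      using assms(4) unfolding fractional_operator_def by (elim conjE continuous_map_funspace)
    moreover have "topspace (path_topology h :: 'n path topology) = path_space h" if "0 < h" "h < 1" for h
      unfolding path_topology_def
      using Metric_space.topspace_mtopology[OF Metric_space_path_space[OF that]] .
    ultimately have "D w \<in> path_space (1 - H)"
      using that assms(1,2) by auto
    then show ?thesis
      by (simp add: path_space_def)
  qed
  then interpret stationary_noise_flow H C3 D F \<sigma> \<Phi> P \<mu> Bt K
    using assms by unfold_locales (auto simp: unique_invariant_measure_def)
  have close: "AE wm in P. AE z in K wm \<Otimes>\<^sub>M K wm. norm (fst z - snd z) \<le> C"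
  proof -
    let ?S = "{(x, y). norm (x - y) > C} :: ((real ^ 'n) \<times> (real ^ 'n)) set"
    have "{z \<in> space (borel \<Otimes>\<^sub>M borel). norm (fst z - snd z :: real ^ 'n) > C} \<in> sets (borel \<Otimes>\<^sub>M borel)"
      by measurable
    then have S: "?S \<in> sets (borel \<Otimes>\<^sub>M borel)"
      by (simp add: space_pair_measure case_prod_unfold)
    have [measurable]: "(\<lambda>wm. emeasure (K wm \<Otimes>\<^sub>M K wm) ?S) \<in> borel_measurable P"
      by (rule measurable_compose[OF measurable_pair_measure[OF measurable_kernel measurable_kernel]
            measurable_emeasure_subprob_algebra[OF S]])
    have "AE wm in P. emeasure (K wm \<Otimes>\<^sub>M K wm) ?S * indicator Bt wm = 0"
      using assms(21) by (subst (asm) nn_integral_0_iff_AE) auto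
    with AE_Bt show ?thesis
    proof eventually_elim
      case (elim wm)
      then have "?S \<in> null_sets (K wm \<Otimes>\<^sub>M K wm)"
        using S Bt_subset sets_pair_kernel[of wm] by (auto simp: null_sets_def)
      then have "AE z in K wm \<Otimes>\<^sub>M K wm. z \<notin> ?S"
        by (rule AE_not_in)
      then show ?case
        by eventually_elim (auto simp: case_prod_unfold)
    qed
  qed
  have dirac: "AE wm in P. \<exists>x. emeasure (K wm) {x} = 1"
    by (rule AE_dirac[OF assms(12,11,20) close assms(22)])
  \<comment> \<open>The random point is the barycentre of \<open>K wm\<close>. It is measurable in
    \<open>wm\<close> as a kernel integral, which avoids a measurable selection; where the integral
    does not exist it takes the default value 0, and at a point mass it is the atom.\<close>
  have "(\<lambda>wm. \<integral>x. x \<partial>K wm) \<in> borel_measurable P"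
    by (rule measurable_compose[OF measurable_kernel integral_measurable_subprob_algebra]) simp
  then have "(\<lambda>wm. \<integral>x. x \<partial>K wm) \<in> borel_measurable (restrict_space P Bt)"
    by (rule measurable_restrict_space1)
  moreover have "AE wm in P. wm \<in> Bt \<longrightarrow> measure_support (K wm) = {\<integral>x. x \<partial>K wm}"
    using dirac AE_space
  proof eventually_elim
    case (elim wm)
    then have wm: "wm \<in> path_space H" by (simp add: space_P)
    interpret K: prob_space "K wm" by (rule prob_kernel[OF wm])
    obtain b where b: "emeasure (K wm) {b} = 1"
      using elim by blast
    have "AE x in K wm. x = b"
      using K.AE_prob_1[of "{b}"] b by (simp add: K.emeasure_eq_measure)
    then have "(\<integral>x. x \<partial>K wm) = (\<integral>x. b \<partial>K wm)"
      using sets_kernel[OF wm] by (intro integral_cong_AE) (auto simp: measurable_cong_sets[OF sets_kernel[OF wm] refl])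
    also have "\<dots> = b"
      using K.prob_space by simp
    finally show ?case
      using measure_support_dirac[OF K.prob_space_axioms sets_kernel[OF wm] b] by simp
  qed
  ultimately show ?thesis
    by blast
qed

end
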